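(* Suppose that $X$ is a standard Borel space and $E$ is a non-measure-hyperfinite projectively-separable countable Borel equivalence relation on $X$. Then $E \times \Delta(\mathbb{R})$ is not measure reducible to a Borel subequivalence relation of $E$.
   Context: For equivalence relations $E$ on $X$ and $F$ on $Y$, $E \times F$ denotes the equivalence relation on $X \times Y$ given by $(x_1, y_1) \mathrel{(E \times F)} (x_2, y_2) \iff (x_1 \mathrel{E} x_2 \text{ and } y_1 \mathrel{F} y_2)$. $\Delta(Y)$ denotes the diagonal (equality relation) on $Y$. An equivalence relation is countable (finite) if all of its classes are countable (finite). For a set $B$, $E \upharpoonright B = E \cap (B \times B)$. A subequivalence relation of an equivalence relation $E$ on $X$ is a subset of $E$ that is an equivalence relation on $X$. A homomorphism from $E$ (on $X$) to $F$ (on $Y$) is a function $\phi \colon X \to Y$ sending $E$-equivalent points to $F$-equivalent points; a reduction is a homomorphism that also sends $E$-inequivalent points to $F$-inequivalent points; $E$ is Borel reducible to $F$ if there is a Borel reduction. For a Borel probability measure $\mu$ on $X$, $E$ is $\mu$-reducible to $F$ if $E \upharpoonright C$ is Borel reducible to $F$ for some $\mu$-conull Borel set $C \subseteq X$. $E$ is measure reducible to $F$ if it is $\mu$-reducible to $F$ for every Borel probability measure $\mu$ on $X$. A Borel equivalence relation $E$ on $X$ is hyperfinite if it is the union of an increasing sequence $(E_n)_{n \in \mathbb{N}}$ of finite Borel subequivalence relations; $\mu$-hyperfinite if $E \upharpoonright C$ is hyperfinite for some $\mu$-conull Borel set $C \subseteq X$; measure hyperfinite if it is $\mu$-hyperfinite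 for every Borel probability measure $\mu$ on $X$; and $\mu$-nowhere hyperfinite if there is no $\mu$-positive Borel set $B \subseteq X$ for which $E \upharpoonright B$ is hyperfinite. A countable Borel equivalence relation $F$ on a standard Borel space $Y$ is projectively separable if whenever $Z$ is a standard Borel space, $E'$ is a countable Borel equivalence relation on $Z$, and $\mu$ is a Borel probability measure on $Z$ for which $E'$ is $\mu$-nowhere hyperfinite, there is a Borel set $R \subseteq Z \times Y$, all of whose vertical sections are countable, such that $\mu(\{z \in B \mid \neg\, z \mathrel{R} \phi(z)\}) = 0$ for every Borel set $B \subseteq Z$ and every countable-to-one Borel homomorphism $\phi \colon B \to Y$ from $E' \upharpoonright B$ to $F$. *)

theory Defs
  imports "HOL-Probability.Probability"
begin

text \<open>
  A Borel space is a value of type \<^typ>\<open>'a measure\<close> of which only the carrier and the sigma-algebra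
  are used; the Borel probability measures on it range over separate values with the same measurable
  sets. For standard Borel spaces the sigma-algebra of \<open>X \<Otimes>\<^sub>M Y\<close> is that of the product space, and
  \<open>restrict_space X B\<close> is the Borel space on a Borel subset \<open>B\<close>.
\<close>

definition standard_borel :: "'a measure \<Rightarrow> bool" where
  "standard_borel X \<longleftrightarrow>
    (\<exists>T. completely_metrizable_space T \<and> separable_space T \<and> topspace T = space X \<and>
         sets X = sigma_sets (topspace T) {U. openin T U})"

definition borel_prob_on :: "'a measure \<Rightarrow> 'a measure \<Rightarrow> bool" where
  "borel_prob_on X \<mu> \<longleftrightarrow> prob_space \<mu> \<and> sets \<mu> = sets X"

definition conull :: "'a measure \<Rightarrow> 'a set \<Rightarrow> bool" where
  "conull \<mu> C \<longleftrightarrow> C \<in> sets \<mu> \<and> space \<mu> - C \<in> null_sets \<mu>"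

definition borel_equiv :: "'a measure \<Rightarrow> 'a rel \<Rightarrow> bool" where
  "borel_equiv X E \<longleftrightarrow> equiv (space X) E \<and> E \<in> sets (X \<Otimes>\<^sub>M X)"

definition countable_borel_equiv :: "'a measure \<Rightarrow> 'a rel \<Rightarrow> bool" where
  "countable_borel_equiv X E \<longleftrightarrow> borel_equiv X E \<and> (\<forall>x\<in>space X. countable (E `` {x}))"

definition finite_borel_equiv :: "'a measure \<Rightarrow> 'a rel \<Rightarrow> bool" where
  "finite_borel_equiv X E \<longleftrightarrow> borel_equiv X E \<and> (\<forall>x\<in>space X. finite (E `` {x}))"

definition borel_subequiv :: "'a measure \<Rightarrow> 'a rel \<Rightarrow> 'a rel \<Rightarrow> bool" where
  "borel_subequiv X F E \<longleftrightarrow> borel_equiv X F \<and> F \<subseteq> E"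

definition product_rel :: "'a rel \<Rightarrow> 'b rel \<Rightarrow> ('a \<times> 'b) rel" where
  "product_rel E F = {((x1, y1), (x2, y2)) | x1 y1 x2 y2. (x1, x2) \<in> E \<and> (y1, y2) \<in> F}"

definition borel_reducible ::
  "'a measure \<Rightarrow> 'a rel \<Rightarrow> 'b measure \<Rightarrow> 'b rel \<Rightarrow> bool" where
  "borel_reducible X E Y F \<longleftrightarrow>
    (\<exists>\<phi>\<in>X \<rightarrow>\<^sub>M Y. \<forall>x\<in>space X. \<forall>y\<in>space X. (x, y) \<in> E \<longleftrightarrow> (\<phi> x, \<phi> y) \<in> F)"

definition mu_reducible ::
  "'a measure \<Rightarrow> 'a measure \<Rightarrow> 'a rel \<Rightarrow> 'b measure \<Rightarrow> 'b rel \<Rightarrow> bool" where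
  "mu_reducible \<mu> X E Y F \<longleftrightarrow>
    (\<exists>C\<in>sets X. conull \<mu> C \<and> borel_reducible (restrict_space X C) (Restr E C) Y F)"

definition measure_reducible ::
  "'a measure \<Rightarrow> 'a rel \<Rightarrow> 'b measure \<Rightarrow> 'b rel \<Rightarrow> bool" where
  "measure_reducible X E Y F \<longleftrightarrow> (\<forall>\<mu>. borel_prob_on X \<mu> \<longrightarrow> mu_reducible \<mu> X E Y F)"

definition hyperfinite :: "'a measure \<Rightarrow> 'a rel \<Rightarrow> bool" where
  "hyperfinite X E \<longleftrightarrow>
    (\<exists>En :: nat \<Rightarrow> 'a rel. incseq En \<and>
       (\<forall>n. finite_borel_equiv X (En n) \<and> borel_subequiv X (En n) E) \<and>
       E = (\<Union>n. En n))"

definition mu_hyperfinite :: "'a measure \<Rightarrow> 'a measure \<Rightarrow> 'a rel \<Rightarrow> bool" where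
  "mu_hyperfinite \<mu> X E \<longleftrightarrow>
    (\<exists>C\<in>sets X. conull \<mu> C \<and> hyperfinite (restrict_space X C) (Restr E C))"

definition measure_hyperfinite :: "'a measure \<Rightarrow> 'a rel \<Rightarrow> bool" where
  "measure_hyperfinite X E \<longleftrightarrow> (\<forall>\<mu>. borel_prob_on X \<mu> \<longrightarrow> mu_hyperfinite \<mu> X E)"

definition mu_nowhere_hyperfinite :: "'a measure \<Rightarrow> 'a measure \<Rightarrow> 'a rel \<Rightarrow> bool" where
  "mu_nowhere_hyperfinite \<mu> X E \<longleftrightarrow>
    \<not> (\<exists>B\<in>sets X. emeasure \<mu> B > 0 \<and> hyperfinite (restrict_space X B) (Restr E B))"

definition countable_to_one_hom ::
  "'a measure \<Rightarrow> 'a rel \<Rightarrow> 'b measure \<Rightarrow> 'b rel \<Rightarrow> ('a \<Rightarrow> 'b) \<Rightarrow> bool" where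
  "countable_to_one_hom X E Y F \<phi> \<longleftrightarrow>
    \<phi> \<in> X \<rightarrow>\<^sub>M Y \<and>
    (\<forall>x\<in>space X. \<forall>y\<in>space X. (x, y) \<in> E \<longrightarrow> (\<phi> x, \<phi> y) \<in> F) \<and>
    (\<forall>y\<in>space Y. countable {x\<in>space X. \<phi> x = y})"

text \<open>
  The auxiliary space \<open>Z\<close> ranges over the standard Borel spaces whose points are real numbers. This
  loses nothing: every standard Borel space is Borel isomorphic to a Borel subset of the reals, and
  the condition on \<open>(Z, E', \<mu>)\<close> is invariant under Borel isomorphism.
  The exceptional set is measurable for Borel \<open>R\<close> and \<open>\<phi>\<close>; membership in \<open>null_sets\<close> is used because
  \<open>emeasure\<close> is 0 by convention on non-measurable sets.
\<close>

definition projectively_separable :: "'b measure \<Rightarrow> 'b rel \<Rightarrow> bool" where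
  "projectively_separable Y F \<longleftrightarrow>
    (\<forall>(Z :: real measure) E' \<mu>.
       standard_borel Z \<and> countable_borel_equiv Z E' \<and> borel_prob_on Z \<mu> \<and>
       mu_nowhere_hyperfinite \<mu> Z E' \<longrightarrow>
       (\<exists>R\<in>sets (Z \<Otimes>\<^sub>M Y).
          (\<forall>z\<in>space Z. countable (R `` {z})) \<and>
          (\<forall>B\<in>sets Z. \<forall>\<phi>.
             countable_to_one_hom (restrict_space Z B) (Restr E' B) Y F \<phi> \<longrightarrow>
             {z\<in>B. (z, \<phi> z) \<notin> R} \<in> null_sets \<mu>)))"

end

theory Submission
  imports Defs
begin

text \<open>
  A non-measure-hyperfinite relation admits a measure \<open>m\<close> for which it is nowhere hyperfinite. A reduction
  of \<open>E \<times> \<Delta>(\<real>)\<close> to a subrelation of \<open>E\<close> on a conull set for \<open>m \<times> \<lambda>\<close>, with \<open>\<lambda>\<close> atomless, gives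
  countable-to-one partial homomorphisms \<open>\<phi>(\<cdot>, r)\<close> from \<open>E\<close> to \<open>E\<close>, so projective separability and Fubini
  yield a point \<open>x\<close> such that \<open>\<phi>(x, r)\<close> lies in one countable set for almost every \<open>r\<close>. But
  \<open>r \<mapsto> \<phi>(x, r)\<close> is injective.

  The measure \<open>m\<close> comes from an exhaustion argument: if no such \<open>m\<close> existed, countably many Borel sets on which
  \<open>E\<close> is hyperfinite would cover almost everything, and hyperfiniteness has to be transferred to their union.
  Instead of Lusin-Novikov uniformization this uses selections defined almost everywhere, obtained from
  measurable hulls of a Souslin scheme, and the fact that a countable-to-one map has purely
  atomic conditional measures, so that almost everywhere it is an increasing union of
  finite-to-one maps.
\<close>

section \<open>Selections off a null set\<close>

text \<open>The set \<open>R\<close> of projective separability is fixed before any homomorphism is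
  chosen, so one \<open>R\<close> captures the whole uncountable family \<phi>(., r), each member up
  to its own null set; Fubini is what turns these uncountably many exceptional sets into a single
  null set of the product. Equal values of \<phi> are related by reflexivity of the target relation,
  so the reduction forces their arguments to be equivalent. With r fixed, this puts each fibre
  inside one countable class of \<open>E\<close>; with x fixed, it gives injectivity in r.

  The obstacle in the gluing step is that a map sending each point to an equivalent point of a
  hyperfinite piece is only countable-to-one, so that pulling a finite relation back along it yields
  countable classes. Finiteness is recovered by keeping only the points whose own conditional mass,
  given their image, is at least 1/(n+1): a fibre holds at most n+1 of them. The kept sets grow with
  n, and pure atomicity ensures that almost every point is eventually kept.\<close>

definition souslin :: "'a set set \<Rightarrow> 'a set set" where
  "souslin G = {S. \<exists>D. range D \<subseteq> G \<and> S = {z. \<exists>\<alpha>::nat \<Rightarrow> nat. \<forall>n. z \<in> D (map \<alpha> [0..<n])}}"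

lemma souslin_base: "A \<in> G \<Longrightarrow> A \<in> souslin G"
  unfolding souslin_def by (intro CollectI exI[of _ "\<lambda>_. A"]) auto

text \<open>The first entry of a branch names the index i, and the remaining entries form a branch
  for \<open>S i\<close>. The root precedes this choice and must exclude nothing, so it carries the
  whole space \<Omega>.\<close>

lemma souslin_UN:
  fixes S :: "nat \<Rightarrow> 'a set"
  assumes S: "\<And>i. S i \<in> souslin G" and \<Omega>: "\<Omega> \<in> G" "G \<subseteq> Pow \<Omega>"
  shows "(\<Union>i. S i) \<in> souslin G"
proof -
  from S have "\<forall>i. \<exists>D. range D \<subseteq> G \<and> S i = {z. \<exists>\<alpha>::nat \<Rightarrow> nat. \<forall>n. z \<in> D (map \<alpha> [0..<n])}"
    unfolding souslin_def mem_Collect_eq by (rule allI)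
  from choice[OF this] obtain D where *: "\<forall>i. range (D i) \<subseteq> G \<and>
      S i = {z. \<exists>\<alpha>::nat \<Rightarrow> nat. \<forall>n. z \<in> D i (map \<alpha> [0..<n])}" ..
  have D: "\<And>i. range (D i) \<subseteq> G"
    and SD: "\<And>i. S i = {z. \<exists>\<alpha>::nat \<Rightarrow> nat. \<forall>n. z \<in> D i (map \<alpha> [0..<n])}"
    using *[rule_format] by (rule conjunct1, rule conjunct2)
  define D' where "D' = (\<lambda>s. case s of [] \<Rightarrow> \<Omega> | i # t \<Rightarrow> D i t)"
  have "range D' \<subseteq> G"
    using D[THEN subsetD, OF rangeI] \<Omega>(1) by (auto simp: D'_def split: list.splits)
  moreover have "(\<Union>i. S i) = {z. \<exists>\<alpha>. \<forall>n. z \<in> D' (map \<alpha> [0..<n])}"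
  proof (intro equalityI subsetI)
    fix z assume "z \<in> (\<Union>i. S i)"
    then obtain i \<alpha> where z: "\<And>n. z \<in> D i (map \<alpha> [0..<n])"
      by (auto simp: SD)
    have "z \<in> D' (map (case_nat i \<alpha>) [0..<n])" for n
    proof (cases n)
      case 0
      then show ?thesis using z[of 0] D[of i] \<Omega> by (auto simp: D'_def)
    next
      case (Suc m)
      then show ?thesis using z[of m] by (simp add: D'_def map_upt_Suc del: upt_Suc)
    qed
    then show "z \<in> {z. \<exists>\<alpha>. \<forall>n. z \<in> D' (map \<alpha> [0..<n])}" by blast
  next
    fix z assume "z \<in> {z. \<exists>\<alpha>. \<forall>n. z \<in> D' (map \<alpha> [0..<n])}"
    then obtain \<alpha> where z: "\<And>n. z \<in> D' (map \<alpha> [0..<n])" by auto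
    have "z \<in> D (\<alpha> 0) (map (\<lambda>i. \<alpha> (Suc i)) [0..<n])" for n
      using z[of "Suc n"] by (simp add: D'_def map_upt_Suc del: upt_Suc)
    then show "z \<in> (\<Union>i. S i)" by (auto simp: SD)
  qed
  ultimately show ?thesis by (auto simp: souslin_def)
qed

text \<open>This makes interleaving work: a prefix of length \<open>prod_encode (i, n)\<close>
  already contains the first n entries of the i-th of countably many interleaved branches.\<close>

lemma prod_encode_strict_mono_snd: "j < n \<Longrightarrow> prod_encode (i, j) < prod_encode (i, n)"
proof (induction n)
  case (Suc n)
  then have "prod_encode (i, n) < prod_encode (i, Suc n)"
    by (simp add: prod_encode_def)
  with Suc show ?case by (cases "j = n") auto
qed simp

text \<open>One branch interleaves the branches of all \<open>S i\<close>. A node whose length codes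
  (i, n) tests the i-th branch on its first n entries, and since every pair is coded by some length,
  every test is made exactly along the branch.\<close>

lemma souslin_INT:
  fixes S :: "nat \<Rightarrow> 'a set"
  assumes S: "\<And>i. S i \<in> souslin G"
  shows "(\<Inter>i. S i) \<in> souslin G"
proof -
  from S have "\<forall>i. \<exists>D. range D \<subseteq> G \<and> S i = {z. \<exists>\<alpha>::nat \<Rightarrow> nat. \<forall>n. z \<in> D (map \<alpha> [0..<n])}"
    unfolding souslin_def mem_Collect_eq by (rule allI)
  from choice[OF this] obtain D where *: "\<forall>i. range (D i) \<subseteq> G \<and>
      S i = {z. \<exists>\<alpha>::nat \<Rightarrow> nat. \<forall>n. z \<in> D i (map \<alpha> [0..<n])}" ..
  have D: "\<And>i. range (D i) \<subseteq> G"
    and SD: "\<And>i. S i = {z. \<exists>\<alpha>::nat \<Rightarrow> nat. \<forall>n. z \<in> D i (map \<alpha> [0..<n])}"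
    using *[rule_format] by (rule conjunct1, rule conjunct2)
  define D' where "D' = (\<lambda>s. case prod_decode (length s) of (i, n) \<Rightarrow>
    D i (map (\<lambda>j. s ! prod_encode (i, j)) [0..<n]))"
  have D': "D' (map \<alpha> [0..<prod_encode (i, n)]) = D i (map (\<lambda>j. \<alpha> (prod_encode (i, j))) [0..<n])"
    for \<alpha> i n
    using prod_encode_strict_mono_snd[of _ n i]
    by (auto simp: D'_def intro!: arg_cong[where f = "D i"])
  have all: "(\<forall>m. z \<in> D' (map \<alpha> [0..<m])) \<longleftrightarrow>
      (\<forall>i n. z \<in> D i (map (\<lambda>j. \<alpha> (prod_encode (i, j))) [0..<n]))" for z \<alpha>
    unfolding D'[symmetric] by (metis prod_decode_inverse surj_pair)
  have "range D' \<subseteq> G"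
    using D[THEN subsetD, OF rangeI] by (auto simp: D'_def split: prod.splits)
  moreover have "(\<Inter>i. S i) = {z. \<exists>\<alpha>. \<forall>n. z \<in> D' (map \<alpha> [0..<n])}"
  proof (intro equalityI subsetI)
    fix z assume "z \<in> (\<Inter>i. S i)"
    then have "\<forall>i. \<exists>\<alpha>. \<forall>n. z \<in> D i (map \<alpha> [0..<n])"
      by (auto simp: SD)
    then obtain a where a: "\<And>i n. z \<in> D i (map (a i) [0..<n])" by metis
    define \<alpha> where "\<alpha> = (\<lambda>k. case prod_decode k of (i, j) \<Rightarrow> a i j)"
    have "\<forall>i n. z \<in> D i (map (\<lambda>j. \<alpha> (prod_encode (i, j))) [0..<n])"
      using a by (simp add: \<alpha>_def)
    then show "z \<in> {z. \<exists>\<alpha>. \<forall>n. z \<in> D' (map \<alpha> [0..<n])}" unfolding all[symmetric] by blast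
  next
    fix z assume "z \<in> {z. \<exists>\<alpha>. \<forall>n. z \<in> D' (map \<alpha> [0..<n])}"
    then show "z \<in> (\<Inter>i. S i)" unfolding all mem_Collect_eq by (auto simp: SD)
  qed
  ultimately show ?thesis by (auto simp: souslin_def)
qed

lemma souslin_Un:
  assumes "A \<in> souslin G" "B \<in> souslin G" "\<Omega> \<in> G" "G \<subseteq> Pow \<Omega>"
  shows "A \<union> B \<in> souslin G"
proof -
  have "(\<Union>i::nat. if i = 0 then A else B) \<in> souslin G"
    using assms(1,2) by (intro souslin_UN[OF _ assms(3,4)]) simp
  moreover have "(\<Union>i::nat. if i = 0 then A else B) = A \<union> B"
    unfolding set_eq_iff UN_iff Un_iff by (metis UNIV_I zero_neq_one)
  ultimately show ?thesis by (simp only:)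
qed

lemma souslin_Int:
  assumes "A \<in> souslin G" "B \<in> souslin G"
  shows "A \<inter> B \<in> souslin G"
proof -
  have "(\<Inter>i::nat. if i = 0 then A else B) \<in> souslin G"
    using assms by (intro souslin_INT) simp
  moreover have "(\<Inter>i::nat. if i = 0 then A else B) = A \<inter> B"
    unfolding set_eq_iff INT_iff Int_iff by (metis UNIV_I zero_neq_one)
  ultimately show ?thesis by (simp only:)
qed

text \<open>The topological input is that open sets of a metrizable space are countable unions of
  closed sets. Closed second sides are wanted because nested closed sets of vanishing size determine
  a point of a complete space; on the first side measurability is enough, as points there are
  handled only up to null sets.\<close>

lemma sets_pair_souslin:
  fixes X :: "'a measure" and Y :: "'b measure"
  assumes T: "metrizable_space T" "topspace T = space Y"
    "sets Y = sigma_sets (topspace T) {U. openin T U}"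
  assumes P: "P \<in> sets (X \<Otimes>\<^sub>M Y)"
  shows "P \<in> souslin {A \<times> C | A C. A \<in> sets X \<and> closedin T C}"
proof -
  let ?G = "{A \<times> C | A C. A \<in> sets X \<and> closedin T C}" and ?\<Omega> = "space X \<times> space Y"
  \<comment> \<open>Souslin sets need not be closed under complement, so the class of good sets asks
    for both a set and its complement to be Souslin.\<close>
  define \<D> where "\<D> = {P. P \<subseteq> ?\<Omega> \<and> P \<in> souslin ?G \<and> ?\<Omega> - P \<in> souslin ?G}"
  have \<Omega>: "?\<Omega> \<in> ?G" "?G \<subseteq> Pow ?\<Omega>"
    using T(2) by (auto dest: sets.sets_into_space closedin_subset)
  have \<D>_rect: "A \<times> C \<in> souslin ?G" if "A \<in> sets X" "closedin T C" for A C
    using that by (auto intro: souslin_base)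
  have \<D>_compl: "?\<Omega> - P \<in> \<D>" if "P \<in> \<D>" for P
    using that by (auto simp: \<D>_def double_diff)
  have \<D>_UN: "(\<Union>i. S i) \<in> \<D>" if "\<And>i::nat. S i \<in> \<D>" for S
  proof -
    have "?\<Omega> - (\<Union>i. S i) = (\<Inter>i. ?\<Omega> - S i)" by auto
    moreover have "(\<Union>i. S i) \<in> souslin ?G" "(\<Inter>i. ?\<Omega> - S i) \<in> souslin ?G"
      using that by (auto simp: \<D>_def intro!: souslin_UN[OF _ \<Omega>] souslin_INT simp del: INT_simps)
    ultimately show ?thesis using that by (auto simp: \<D>_def)
  qed
  have \<D>_Int: "A \<inter> B \<in> \<D>" if "A \<in> \<D>" "B \<in> \<D>" for A B
  proof -
    have "?\<Omega> - A \<inter> B = (?\<Omega> - A) \<union> (?\<Omega> - B)" by auto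
    then show ?thesis
      using that souslin_Un[OF _ _ \<Omega>, of "?\<Omega> - A" "?\<Omega> - B"] souslin_Int[of A ?G B]
      by (auto simp: \<D>_def)
  qed
  have empty: "{} \<in> \<D>"
    using \<D>_rect[of "{}" "{}"] souslin_base[OF \<Omega>(1)] by (auto simp: \<D>_def)
  have left: "A \<times> space Y \<in> \<D>" if "A \<in> sets X" for A
  proof -
    have "?\<Omega> - A \<times> space Y = (space X - A) \<times> space Y" by auto
    moreover have "(space X - A) \<times> space Y \<in> souslin ?G" "A \<times> space Y \<in> souslin ?G"
      using that T(2) closedin_topspace[of T] by (auto intro!: \<D>_rect)
    ultimately show ?thesis using sets.sets_into_space[OF that] by (auto simp: \<D>_def)
  qed
  have right: "space X \<times> B \<in> \<D>" if "B \<in> sets Y" for B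
  proof -
    have "B \<in> sigma_sets (topspace T) {U. openin T U}" using that T by simp
    then show ?thesis
    proof induction
      case (Basic U)
      then have "fsigma_in T U" using open_imp_fsigma_in[OF T(1)] by auto
      then obtain C where C: "\<And>n::nat. closedin T (C n)" "U = (\<Union>n. C n)"
        unfolding fsigma_in_ascending by auto
      have "space X \<times> U = (\<Union>n. space X \<times> C n)" using C by auto
      then have "space X \<times> U \<in> souslin ?G"
        using C by (auto intro!: souslin_UN[OF _ \<Omega>] \<D>_rect simp del: UN_simps)
      moreover have "?\<Omega> - space X \<times> U = space X \<times> (topspace T - U)" using T by auto
      moreover have "space X \<times> (topspace T - U) \<in> souslin ?G"
        using Basic by (intro \<D>_rect) auto
      moreover have "U \<subseteq> space Y" using Basic T openin_subset[of T U] by auto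
      ultimately show ?case by (auto simp: \<D>_def)
    next
      case Empty then show ?case using empty by simp
    next
      case (Compl a)
      have "space X \<times> (topspace T - a) = ?\<Omega> - space X \<times> a" using T by auto
      then show ?case using \<D>_compl[OF Compl.IH] by simp
    next
      case (Union a)
      have "space X \<times> (\<Union>i. a i) = (\<Union>i. space X \<times> a i)" by auto
      then show ?case using \<D>_UN[of "\<lambda>i. space X \<times> a i", OF Union.IH] by simp
    qed
  qed
  have "P \<in> sigma_sets ?\<Omega> {a \<times> b | a b. a \<in> sets X \<and> b \<in> sets Y}"
    using P by (simp add: sets_pair_measure)
  then have "P \<in> \<D>"
  proof induction
    case (Basic R)
    then obtain A B where AB: "R = A \<times> B" "A \<in> sets X" "B \<in> sets Y" by auto
    then have "R = (A \<times> space Y) \<inter> (space X \<times> B)"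
      using sets.sets_into_space[of A X] sets.sets_into_space[of B Y] by auto
    then show ?case using \<D>_Int left right AB by metis
  qed (use empty \<D>_compl \<D>_UN in auto)
  then show ?thesis by (simp add: \<D>_def)
qed

text \<open>
  Each piece of the Souslin operation is replaced by a measurable hull. Up to a null set the hull
  of a node is covered by the hulls of its children, so off that null set a branch can be followed
  by always going to the least admissible child.
\<close>

lemma measurable_branch_selection:
  fixes M :: "'a measure" and A :: "nat list \<Rightarrow> 'a set"
  assumes "finite_measure M" and A: "\<And>s. A s \<in> sets M"
  obtains S N \<sigma> where "S \<in> sets M" "N \<in> null_sets M"
    "\<And>n. (\<lambda>x. map (\<sigma> x) [0..<n]) \<in> M \<rightarrow>\<^sub>M count_space UNIV"
    "\<And>x n. x \<in> S \<Longrightarrow> x \<in> A (map (\<sigma> x) [0..<n])"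
    "\<And>x \<alpha>. \<forall>n. x \<in> A (map \<alpha> [0..<n]) \<Longrightarrow> x \<in> S \<union> N"
proof -
  interpret finite_measure M by fact
  \<comment> \<open>\<open>T s\<close> collects the points with an admissible branch through s. It
    is a projection and may fail to be measurable, which is why hulls are taken.\<close>
  define T where "T s = {x. \<exists>\<alpha>. map \<alpha> [0..<length s] = s \<and> (\<forall>n. x \<in> A (map \<alpha> [0..<n]))}" for s
  have T_A: "T s \<subseteq> A s" for s
  proof
    fix x assume "x \<in> T s"
    then obtain \<alpha> where "map \<alpha> [0..<length s] = s" "\<forall>n. x \<in> A (map \<alpha> [0..<n])"
      by (auto simp: T_def)
    then show "x \<in> A s" by metis
  qed
  have T_child: "T s \<subseteq> (\<Union>k. T (s @ [k]))" for s
  proof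
    fix x assume "x \<in> T s"
    then obtain \<alpha> where "map \<alpha> [0..<length s] = s" "\<forall>n. x \<in> A (map \<alpha> [0..<n])"
      by (auto simp: T_def)
    then have "x \<in> T (s @ [\<alpha> (length s)])" unfolding T_def by auto
    then show "x \<in> (\<Union>k. T (s @ [k]))" by blast
  qed
  have "\<exists>B. B \<in> sets M \<and> T s \<subseteq> B \<and> B \<subseteq> A s \<and> (\<forall>F\<in>sets M. F \<subseteq> B - T s \<longrightarrow> emeasure M F = 0)" for s
  proof -
    have "T s \<subseteq> space M" using T_A[of s] sets.sets_into_space[OF A] by blast
    then obtain E where E: "E \<in> sets M" "T s \<subseteq> E" "outer_measure_of M (T s) = emeasure M E"
      using outer_measure_of_attain by metis
    then have "measurable_envelope M (T s) E"
      by (subst measurable_envelope_eq2) (auto simp: less_top[symmetric])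
    then have "\<forall>F\<in>sets M. F \<subseteq> E - T s \<longrightarrow> emeasure M F = 0"
      using measurable_envelopeD1 by blast
    \<comment> \<open>Cutting the hull down to \<open>A s\<close> still covers \<open>T s\<close>,
      and a smaller set has no new measurable subsets missing \<open>T s\<close>.\<close>
    then show ?thesis
      using E T_A[of s] A[of s] by (intro exI[of _ "E \<inter> A s"]) auto
  qed
  then obtain B where B: "\<And>s. B s \<in> sets M" "\<And>s. T s \<subseteq> B s" "\<And>s. B s \<subseteq> A s"
      "\<And>s F. F \<in> sets M \<Longrightarrow> F \<subseteq> B s - T s \<Longrightarrow> emeasure M F = 0"
    by metis
  \<comment> \<open>What a hull has outside the hulls of its children misses \<open>T s\<close>,
    because every branch through s passes through some child; the hull property makes it null. There
    are only countably many nodes s.\<close>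
  define N where "N = (\<Union>s. B s - (\<Union>k. B (s @ [k])))"
  have N: "N \<in> null_sets M"
    unfolding N_def
  proof (intro null_sets_UN null_setsI)
    fix s
    show "B s - (\<Union>k. B (s @ [k])) \<in> sets M" using B(1) by auto
    then show "emeasure M (B s - (\<Union>k. B (s @ [k]))) = 0"
      using T_child[of s] B(2) by (intro B(4)[where s = s]) auto
  qed
  define p where "p n x = rec_nat [] (\<lambda>_ s. s @ [LEAST k. x \<in> B (s @ [k])]) n" for n x
  define \<sigma> where "\<sigma> x n = (LEAST k. x \<in> B (p n x @ [k]))" for x n
  have p_0: "p 0 x = []" and p_Suc: "p (Suc n) x = p n x @ [LEAST k. x \<in> B (p n x @ [k])]" for n x
    by (auto simp: p_def)
  have p_eq: "map (\<sigma> x) [0..<n] = p n x" for x n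
    by (induction n) (auto simp: p_0 p_Suc \<sigma>_def)
  have p_meas: "p n \<in> M \<rightarrow>\<^sub>M count_space UNIV" for n
  proof (induction n)
    case 0
    then show ?case by (simp add: p_0 cong: measurable_cong)
  next
    case (Suc n)
    have "(\<lambda>x. s @ [LEAST k. x \<in> B (s @ [k])]) \<in> M \<rightarrow>\<^sub>M count_space UNIV" for s
    proof -
      have [measurable]: "B (s @ [k]) \<in> sets M" for k by (rule B)
      have "(\<lambda>x. LEAST k. x \<in> B (s @ [k])) \<in> M \<rightarrow>\<^sub>M count_space UNIV" by measurable
      then show ?thesis by (rule measurable_compose) simp
    qed
    from measurable_compose_countable[OF this Suc] show ?case by (simp add: p_Suc[abs_def])
  qed
  have p_B: "x \<in> B (p n x)" if "x \<in> B [] - N" for x n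
  proof (induction n)
    case (Suc n)
    with that have "\<exists>k. x \<in> B (p n x @ [k])" unfolding N_def by blast
    then show ?case unfolding p_Suc by (rule LeastI_ex)
  qed (use that in \<open>simp add: p_0\<close>)
  show ?thesis
  proof (rule that[of "B [] - N" N \<sigma>])
    fix x \<alpha> assume "\<forall>n. x \<in> A (map \<alpha> [0..<n])"
    then have "x \<in> T []" by (auto simp: T_def)
    then show "x \<in> (B [] - N) \<union> N" using B(2) by auto
  qed (use B N p_meas p_B in \<open>auto simp: p_eq subset_eq\<close>)
qed


text \<open>Cantor's intersection theorem with explicit radii. The index is shifted by one because
  the set at the root of a scheme is subject to no ball constraint.\<close>

lemma (in Metric_space) sing_in_nested_closed:
  assumes "mcomplete" "\<And>n::nat. closedin mtopology (C n)" "\<And>n. C n \<noteq> {}"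
    "decseq C" "\<And>n. C (Suc n) \<subseteq> mcball (a n) (1 / Suc n)"
  shows "\<exists>l\<in>M. \<Inter>(range C) = {l}"
proof -
  have "\<exists>n b. C n \<subseteq> mcball b e" if "e > 0" for e :: real
  proof -
    obtain n where "1 / Suc n < e" using nat_approx_posE[OF \<open>e > 0\<close>] by auto
    then have "mcball (a n) (1 / Suc n) \<subseteq> mcball (a n) e"
      by (intro mcball_subset_concentric) auto
    then show ?thesis using assms(5)[of n] by blast
  qed
  then show ?thesis
    using assms(1)[unfolded mcomplete_nest_sing, rule_format, of C] assms(2-4) by blast
qed

text \<open>
  Substitute for the uniformization theorems of descriptive set theory, valid up to a null set.
\<close>

theorem measurable_selection:
  fixes M :: "'a measure" and Y :: "'b measure"
  assumes M: "finite_measure M" and Y: "standard_borel Y"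
    and P: "P \<in> sets (M \<Otimes>\<^sub>M Y)" and g: "g \<in> M \<rightarrow>\<^sub>M Y"
  obtains S N f where "S \<in> sets M" "N \<in> null_sets M" "f \<in> M \<rightarrow>\<^sub>M Y"
    "\<And>x. x \<in> S \<Longrightarrow> (x, f x) \<in> P" "\<And>x y. (x, y) \<in> P \<Longrightarrow> x \<in> S \<union> N"
proof -
  from Y obtain T where T: "completely_metrizable_space T" "separable_space T"
    "topspace T = space Y" "sets Y = sigma_sets (topspace T) {U. openin T U}"
    by (auto simp: standard_borel_def)
  then obtain M' d where Md: "Metric_space M' d" "Metric_space.mcomplete M' d"
    "T = Metric_space.mtopology M' d"
    by (auto simp: completely_metrizable_space_def)
  interpret Y: Metric_space M' d by fact
  have M': "M' = space Y" using T(3) Md(3) by simp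
  obtain Q where Q: "countable Q" "Q \<subseteq> space Y" "T closure_of Q = space Y"
    using T(2,3) by (auto simp: separable_space_def)
  define q where "q = from_nat_into Q"
  have q: "\<exists>k. y \<in> Y.mcball (q k) r" if "y \<in> space Y" "r > 0" for y r
  proof -
    have "y \<in> T closure_of Q" using that Q by simp
    then obtain c where c: "c \<in> Q" "c \<in> Y.mball y r"
      using \<open>r > 0\<close> unfolding Md(3) Y.metric_closure_of by auto
    then obtain k where "q k = c"
      unfolding q_def using from_nat_into_surj[OF Q(1)] by blast
    with c have "y \<in> Y.mcball (q k) r" by (auto simp: Y.commute)
    then show ?thesis ..
  qed
  have "P \<in> souslin {A \<times> C | A C. A \<in> sets M \<and> closedin T C}"
    by (rule sets_pair_souslin[OF completely_metrizable_imp_metrizable_space[OF T(1)] T(3,4) P])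
  then obtain D where D: "range D \<subseteq> {A \<times> C | A C. A \<in> sets M \<and> closedin T C}"
    and PD: "P = {z. \<exists>\<alpha>::nat \<Rightarrow> nat. \<forall>n. z \<in> D (map \<alpha> [0..<n])}"
    by (auto simp: souslin_def)
  from D have "\<forall>s. \<exists>A C. D s = A \<times> C \<and> A \<in> sets M \<and> closedin T C" by blast
  then obtain A C where AC: "\<And>s. D s = A s \<times> C s" "\<And>s. A s \<in> sets M" "\<And>s. closedin T (C s)"
    by metis

  \<comment> \<open>A branch codes a branch of \<open>D\<close> together with the indices of shrinking balls around \<open>y\<close>.\<close>
  define u where "u = map (fst \<circ> prod_decode)"
  define C1 where "C1 s = C (u s) \<inter> (if s = [] then space Y
    else Y.mcball (q (snd (prod_decode (last s)))) (1 / length s))" for s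
  \<comment> \<open>Intersecting over all prefixes makes the closed sets decrease along every
    branch.\<close>
  define C2 where "C2 s = (\<Inter>k\<in>{..length s}. C1 (take k s))" for s
  \<comment> \<open>An empty closed part empties the measurable part too. Hence a point that stays
    in \<open>A2\<close> along a branch has non-empty nested closed sets there, and completeness
    supplies the selected value.\<close>
  define A2 where "A2 s = (if C2 s = {} then {} else A (u s))" for s
  have C2: "C2 s \<subseteq> C1 s" "closedin T (C2 s)" for s
  proof -
    show "C2 s \<subseteq> C1 s" unfolding C2_def by (rule INF_lower2[of "length s"]) auto
    have "closedin T (C1 s)" for s
    proof -
      have "closedin T (space Y)" using closedin_topspace[of T] T(3) by simp
      moreover have "closedin T (Y.mcball a r)" for a r
        unfolding Md(3) by (rule Y.closedin_mcball)
      ultimately show ?thesis using AC(3) by (simp add: C1_def closedin_Int)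
    qed
    then show "closedin T (C2 s)" unfolding C2_def by (intro closedin_INT) auto
  qed
  have C2_map: "C2 (map \<alpha> [0..<n]) = (\<Inter>k\<in>{..n}. C1 (map \<alpha> [0..<k]))" for \<alpha> n
    unfolding C2_def by (intro INF_cong) (auto simp: take_map min_absorb1)
  have C2_dec: "decseq (\<lambda>n. C2 (map \<alpha> [0..<n]))" for \<alpha>
    unfolding C2_map by (intro decseq_SucI INF_superset_mono) auto
  have sing: "\<exists>l\<in>M'. (\<Inter>n. C2 (map \<alpha> [0..<n])) = {l}" if "\<And>n. C2 (map \<alpha> [0..<n]) \<noteq> {}" for \<alpha>
  proof (rule Y.sing_in_nested_closed[OF Md(2) _ that C2_dec])
    show "closedin Y.mtopology (C2 (map \<alpha> [0..<n]))" for n using C2(2) Md(3) by simp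
    show "C2 (map \<alpha> [0..<Suc n]) \<subseteq> Y.mcball (q (snd (prod_decode (\<alpha> n)))) (1 / Suc n)" for n
      using C2(1)[of "map \<alpha> [0..<Suc n]"] by (auto simp: C1_def)
  qed
  have A2: "A2 s \<in> sets M" for s using AC(2) by (simp add: A2_def)
  obtain S N \<sigma> where S: "S \<in> sets M" and N: "N \<in> null_sets M"
    and \<sigma>: "\<And>n. (\<lambda>x. map (\<sigma> x) [0..<n]) \<in> M \<rightarrow>\<^sub>M count_space UNIV"
      "\<And>x n. x \<in> S \<Longrightarrow> x \<in> A2 (map (\<sigma> x) [0..<n])"
    and SN: "\<And>x \<alpha>. \<forall>n. x \<in> A2 (map \<alpha> [0..<n]) \<Longrightarrow> x \<in> S \<union> N"
    by (rule measurable_branch_selection[OF M A2]) (rule that)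
  have C2_ne: "C2 (map (\<sigma> x) [0..<n]) \<noteq> {}" if "x \<in> S" for x n
    using \<sigma>(2)[OF that, of n] by (auto simp: A2_def split: if_splits)
  define f where "f x = (if x \<in> S then THE l. (\<Inter>n. C2 (map (\<sigma> x) [0..<n])) = {l} else g x)" for x
  have f_g: "f x = g x" if "x \<notin> S" for x using that by (simp add: f_def)
  have f: "(\<Inter>n. C2 (map (\<sigma> x) [0..<n])) = {f x}" "f x \<in> space Y" if x: "x \<in> S" for x
  proof -
    obtain l where l: "l \<in> M'" "(\<Inter>n. C2 (map (\<sigma> x) [0..<n])) = {l}"
      using sing[OF C2_ne[OF x]] by blast
    moreover have "f x = l" using x l(2) by (simp add: f_def)
    ultimately show "(\<Inter>n. C2 (map (\<sigma> x) [0..<n])) = {f x}" "f x \<in> space Y" using M' by auto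
  qed
  \<comment> \<open>Membership in a closed set is decided by countably many conditions on prefixes,
    which yields measurability of f. If \<open>F\<close> meets every \<open>C2\<close> along the
    branch, the intersections shrink to a point by completeness; it lies in all the sets
    \<open>C2\<close>, hence equals f x.\<close>
  have f_closed: "f x \<in> F \<longleftrightarrow> (\<forall>n. C2 (map (\<sigma> x) [0..<n]) \<inter> F \<noteq> {})"
    if x: "x \<in> S" and F: "closedin T F" for x F
  proof
    assume "f x \<in> F"
    then show "\<forall>n. C2 (map (\<sigma> x) [0..<n]) \<inter> F \<noteq> {}" using f(1)[OF x] by blast
  next
    assume ne: "\<forall>n. C2 (map (\<sigma> x) [0..<n]) \<inter> F \<noteq> {}"
    have "\<exists>l\<in>M'. (\<Inter>n. C2 (map (\<sigma> x) [0..<n]) \<inter> F) = {l}"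
    proof (rule Y.sing_in_nested_closed[OF Md(2)])
      show "closedin Y.mtopology (C2 (map (\<sigma> x) [0..<n]) \<inter> F)" for n
        using C2(2) F Md(3) by auto
      show "decseq (\<lambda>n. C2 (map (\<sigma> x) [0..<n]) \<inter> F)"
        using C2_dec[of "\<sigma> x"] unfolding decseq_def by blast
      show "C2 (map (\<sigma> x) [0..<Suc n]) \<inter> F \<subseteq> Y.mcball (q (snd (prod_decode (\<sigma> x n)))) (1 / Suc n)"
        for n using C2(1)[of "map (\<sigma> x) [0..<Suc n]"] by (auto simp: C1_def)
    qed (use ne in blast)
    then obtain l where "l \<in> (\<Inter>n. C2 (map (\<sigma> x) [0..<n]) \<inter> F)" by (metis singletonI)
    then have "l \<in> (\<Inter>n. C2 (map (\<sigma> x) [0..<n]))" "l \<in> F" by auto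
    then show "f x \<in> F" unfolding f(1)[OF x] by simp
  qed
  have "f \<in> M \<rightarrow>\<^sub>M Y"
  proof (rule measurable_sigma_sets[OF T(4)])
    show "f \<in> space M \<rightarrow> topspace T"
      using f(2) measurable_space[OF g] T(3) by (auto simp: f_def)
  next
    fix U assume "U \<in> {U. openin T U}"
    then have U: "openin T U" by simp
    then have F: "closedin T (topspace T - U)" by auto
    have "{x \<in> space M. C2 (map (\<sigma> x) [0..<n]) \<inter> (topspace T - U) \<noteq> {}} \<in> sets M" for n
      using measurable_sets[OF \<sigma>(1)[of n], of "{s. C2 s \<inter> (topspace T - U) \<noteq> {}}"]
      by (simp add: vimage_def Collect_conj_eq Int_commute)
    then have W: "{x \<in> space M. \<forall>n. C2 (map (\<sigma> x) [0..<n]) \<inter> (topspace T - U) \<noteq> {}} \<in> sets M"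
      (is "?W \<in> _") by (rule sets.sets_Collect_countable_All)
    have g_U: "g -` U \<inter> space M \<in> sets M"
      using U T(4) by (intro measurable_sets[OF g]) auto
    have f_U: "f x \<in> U \<longleftrightarrow> x \<notin> ?W" if "x \<in> S" for x
      using f_closed[OF that F] f(2)[OF that] T(3) sets.sets_into_space[OF S] that by blast
    have "f -` U \<inter> space M = (S - ?W) \<union> (g -` U \<inter> space M - S)"
    proof (rule set_eqI)
      fix x show "x \<in> f -` U \<inter> space M \<longleftrightarrow> x \<in> (S - ?W) \<union> (g -` U \<inter> space M - S)"
        using sets.sets_into_space[OF S] f_U[of x] f_g[of x] by (cases "x \<in> S") auto
    qed
    with S W g_U show "f -` U \<inter> space M \<in> sets M" by simp
  qed (auto dest: openin_subset)
  moreover have "(x, f x) \<in> P" if x: "x \<in> S" for x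
  proof -
    have "(x, f x) \<in> D (map (fst \<circ> prod_decode \<circ> \<sigma> x) [0..<n])" for n
    proof -
      have "f x \<in> C2 (map (\<sigma> x) [0..<n])" using f(1)[OF x] by blast
      then have "f x \<in> C (u (map (\<sigma> x) [0..<n]))" using C2(1) by (auto simp: C1_def)
      moreover have "x \<in> A (u (map (\<sigma> x) [0..<n]))"
        using \<sigma>(2)[OF x, of n] by (auto simp: A2_def split: if_splits)
      ultimately show ?thesis by (simp add: AC(1) u_def comp_assoc)
    qed
    then show ?thesis unfolding PD by blast
  qed
  moreover have "x \<in> S \<union> N" if xy: "(x, y) \<in> P" for x y
  proof -
    have y: "y \<in> space Y" using sets.sets_into_space[OF P] xy by (auto simp: space_pair_measure)
    obtain \<beta> where \<beta>: "\<And>n. (x, y) \<in> D (map \<beta> [0..<n])" using xy unfolding PD by blast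
    have "\<forall>n. \<exists>k. y \<in> Y.mcball (q k) (1 / Suc n)" using q[OF y] by simp
    then obtain \<gamma> where \<gamma>: "\<And>n. y \<in> Y.mcball (q (\<gamma> n)) (1 / Suc n)" by metis
    \<comment> \<open>The branch merges a branch \<beta> of \<open>D\<close> through (x, y) with the
      indices \<gamma> of balls around y. The entry at position n fixes the ball of radius 1/(n+1),
      seen at the node of length n+1; hence the index n - 1 below.\<close>
    define \<alpha> where "\<alpha> n = prod_encode (\<beta> n, \<gamma> n)" for n
    have u: "u (map \<alpha> [0..<n]) = map \<beta> [0..<n]" for n by (simp add: u_def \<alpha>_def)
    have "y \<in> C1 (map \<alpha> [0..<n])" for n
    proof -
      have "y \<in> C (u (map \<alpha> [0..<n]))" using \<beta>[of n] by (simp add: u AC(1))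
      then show ?thesis
        using \<gamma>[of "n - 1"] y
        by (cases n) (auto simp: C1_def \<alpha>_def simp del: Y.in_mcball)
    qed
    then have "y \<in> C2 (map \<alpha> [0..<n])" for n unfolding C2_map by blast
    then have "\<forall>n. x \<in> A2 (map \<alpha> [0..<n])"
      using \<beta> by (auto simp: A2_def u AC(1))
    then show ?thesis by (rule SN)
  qed
  ultimately show ?thesis using that S N by blast
qed

section \<open>Injections into the reals and conditional distributions\<close>

text \<open>Base 3 avoids the ambiguity of binary expansions: everything after position k
  contributes at most half of (1/3)^k, so the first differing digit decides the order.\<close>

lemma ternary_series_less:
  fixes a b :: "nat \<Rightarrow> bool"
  assumes k: "\<And>i. i < k \<Longrightarrow> a i = b i" "a k" "\<not> b k"
  shows "(\<Sum>i. of_bool (b i) * (1/3) ^ i) < (\<Sum>i. of_bool (a i) * (1/3) ^ i :: real)"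
proof -
  have sm: "summable (\<lambda>i. of_bool (c i) * (1/3) ^ i :: real)" for c :: "nat \<Rightarrow> bool"
    by (rule summable_comparison_test'[where g = "\<lambda>i. (1/3) ^ i" and N = 0])
       (auto simp: summable_geometric)
  define s :: "nat \<Rightarrow> real" where "s i = (of_bool (a i) - of_bool (b i)) * (1/3) ^ i" for i
  have s: "summable s"
    unfolding s_def left_diff_distrib by (intro summable_diff sm)
  have g: "(\<lambda>i. (1/3) ^ (i + Suc k) :: real) sums ((1/3) ^ Suc k * (3/2))"
  proof -
    have "(\<lambda>i. (1/3) ^ i :: real) sums (1 / (1 - 1/3))" by (rule geometric_sums) simp
    then have "(\<lambda>i. (1/3) ^ Suc k * (1/3) ^ i :: real) sums ((1/3) ^ Suc k * (1 / (1 - 1/3)))"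
      by (rule sums_mult)
    then show ?thesis by (simp add: power_add mult_ac)
  qed
  have "- (\<Sum>i. s (i + Suc k)) \<le> (\<Sum>i. (1/3) ^ (i + Suc k))"
    unfolding suminf_minus[OF summable_ignore_initial_segment[OF s], symmetric]
    by (intro suminf_le summable_minus summable_ignore_initial_segment[OF s] sums_summable[OF g])
       (auto simp: s_def)
  also have "\<dots> < (1/3) ^ k"
    unfolding sums_unique[OF g, symmetric] by simp
  finally have "0 < (1/3) ^ k + (\<Sum>i. s (i + Suc k))" by simp
  also have "(1/3) ^ k = (\<Sum>i<Suc k. s i)"
    using k by (simp add: s_def)
  also have "\<dots> + (\<Sum>i. s (i + Suc k)) = (\<Sum>i. s i)"
    using suminf_split_initial_segment[OF s, of "Suc k"] by simp
  also have "\<dots> = (\<Sum>i. of_bool (a i) * (1/3) ^ i) - (\<Sum>i. of_bool (b i) * (1/3) ^ i)"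
    unfolding s_def left_diff_distrib by (rule suminf_diff[OF sm sm, symmetric])
  finally show ?thesis by simp
qed

lemma ternary_series_eqD:
  fixes a b :: "nat \<Rightarrow> bool"
  assumes "(\<Sum>i. of_bool (a i) * (1/3) ^ i) = (\<Sum>i. of_bool (b i) * (1/3) ^ i :: real)"
  shows "a = b"
proof (rule ccontr)
  assume "a \<noteq> b"
  then have "\<exists>k. a k \<noteq> b k" by auto
  then obtain k where "a k \<noteq> b k" and min: "\<And>i. i < k \<Longrightarrow> a i = b i"
    using exists_least_iff[of "\<lambda>k. a k \<noteq> b k"] by auto
  then consider "a k" "\<not> b k" | "b k" "\<not> a k" by auto
  then show False
  proof cases
    case 1
    then show False using ternary_series_less[of k a b] min assms by simp
  next
    case 2
    then show False using ternary_series_less[of k b a] min assms by simp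
  qed
qed

text \<open>Balls of radius 1/(n+1) around a countable dense set separate points. The sequence
  recording which of these balls contain x is then coded as a real number with ternary digits 0 and
  1.\<close>

lemma standard_borel_real_injection:
  assumes "standard_borel X"
  shows "\<exists>e :: 'a \<Rightarrow> real. e \<in> borel_measurable X \<and> inj_on e (space X)"
proof -
  from assms obtain T where T: "completely_metrizable_space T" "separable_space T"
    "topspace T = space X" "sets X = sigma_sets (topspace T) {U. openin T U}"
    by (auto simp: standard_borel_def)
  then obtain M' d where Md: "Metric_space M' d" "T = Metric_space.mtopology M' d"
    by (auto simp: completely_metrizable_space_def)
  interpret X: Metric_space M' d by fact
  have M': "M' = space X" using T(3) Md(2) by simp
  obtain Q where Q: "countable Q" "Q \<subseteq> space X" "T closure_of Q = space X"
    using T(2,3) by (auto simp: separable_space_def)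
  define b where "b i = X.mball (from_nat_into Q (fst (prod_decode i))) (1 / Suc (snd (prod_decode i)))" for i
  have b: "b i \<in> sets X" for i
    unfolding T(4) by (rule sigma_sets.Basic) (simp add: b_def Md(2))
  have sep: "\<exists>i. x \<in> b i \<and> y \<notin> b i" if xy: "x \<in> space X" "y \<in> space X" "x \<noteq> y" for x y
  proof -
    have "d x y > 0" using xy M' by simp
    \<comment> \<open>With radius below half the distance, a ball containing x and y would
      contradict the triangle inequality.\<close>
    then obtain n where n: "1 / Suc n < d x y / 2" using nat_approx_posE[of "d x y / 2"] by auto
    have "x \<in> T closure_of Q" using xy Q by simp
    then have "\<forall>r>0. \<exists>c\<in>Q. c \<in> X.mball x r"
      unfolding Md(2) X.metric_closure_of by simp
    moreover have "1 / Suc n > (0 :: real)" by simp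
    ultimately obtain c where c: "c \<in> Q" "c \<in> X.mball x (1 / Suc n)" by metis
    then obtain k where k: "from_nat_into Q k = c" using from_nat_into_surj[OF Q(1)] by blast
    have "c \<in> M'" using c by simp
    then have "d x y \<le> d c x + d c y" using xy X.triangle''[of x c y] by (simp add: M')
    moreover have "d c x < 1 / Suc n" "x \<in> M'" using c(2) X.commute[of c x] by (simp_all del: of_nat_Suc)
    ultimately have "x \<in> X.mball c (1 / Suc n)" "y \<notin> X.mball c (1 / Suc n)"
      using \<open>c \<in> M'\<close> n by (auto simp del: of_nat_Suc)
    then have "x \<in> b (prod_encode (k, n)) \<and> y \<notin> b (prod_encode (k, n))"
      by (simp add: b_def k del: of_nat_Suc)
    then show ?thesis ..
  qed
  define e where "e x = (\<Sum>i. of_bool (x \<in> b i) * (1/3) ^ i :: real)" for x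
  have "e \<in> borel_measurable X"
    unfolding e_def
  proof (intro borel_measurable_suminf borel_measurable_times borel_measurable_const)
    fix i
    have "(\<lambda>x. indicator (b i) x :: real) \<in> borel_measurable X" using b by simp
    then show "(\<lambda>x. of_bool (x \<in> b i) :: real) \<in> borel_measurable X"
      by (simp add: indicator_def)
  qed
  moreover have "inj_on e (space X)"
  proof (rule inj_onI, rule ccontr)
    fix x y assume "x \<in> space X" "y \<in> space X" "e x = e y" "x \<noteq> y"
    then show False
      using sep ternary_series_eqD[of "\<lambda>i. x \<in> b i" "\<lambda>i. y \<in> b i"] unfolding e_def by (metis (full_types))
  qed
  ultimately show ?thesis by blast
qed

section \<open>Conditional distribution functions by way of Radon-Nikodym densities\<close>

lemma AE_le_if_set_nn_integral_le:
  fixes f g :: "'a \<Rightarrow> ennreal"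
  assumes [measurable]: "f \<in> borel_measurable M" "g \<in> borel_measurable M"
    and fin: "(\<integral>\<^sup>+x. g x \<partial>M) \<noteq> \<infinity>"
    and le: "\<And>A. A \<in> sets M \<Longrightarrow> (\<integral>\<^sup>+x. f x * indicator A x \<partial>M) \<le> (\<integral>\<^sup>+x. g x * indicator A x \<partial>M)"
  shows "AE x in M. f x \<le> g x"
proof -
  \<comment> \<open>Testing the hypothesis on the set where the claim fails shows that the excess f
    - g has integral 0 there; finiteness of the integral of g permits the cancellation.\<close>
  define A where "A = {x \<in> space M. g x < f x}"
  have A [measurable]: "A \<in> sets M" unfolding A_def by measurable
  let ?g = "\<integral>\<^sup>+x. g x * indicator A x \<partial>M"
  have "?g \<le> (\<integral>\<^sup>+x. g x \<partial>M)" by (intro nn_integral_mono) (auto simp: indicator_def)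
  then have g_fin: "?g \<noteq> \<infinity>" using fin by (auto simp: top_unique)
  have "(\<integral>\<^sup>+x. (f x - g x) * indicator A x \<partial>M) + ?g = (\<integral>\<^sup>+x. (f x - g x) * indicator A x + g x * indicator A x \<partial>M)"
    by (subst nn_integral_add) auto
  also have "\<dots> = (\<integral>\<^sup>+x. f x * indicator A x \<partial>M)"
    by (intro nn_integral_cong) (auto simp: A_def indicator_def diff_add_self_ennreal)
  also have "\<dots> \<le> 0 + ?g" using le[OF A] by simp
  finally have "(\<integral>\<^sup>+x. (f x - g x) * indicator A x \<partial>M) = 0"
    using g_fin by (simp add: ennreal_add_left_cancel_le add.commute top_unique)
  then have "AE x in M. (f x - g x) * indicator A x = 0"
    by (subst (asm) nn_integral_0_iff_AE) auto
  then show ?thesis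
  proof (rule AE_mp, intro AE_I2 impI)
    fix x assume x: "x \<in> space M" "(f x - g x) * indicator A x = 0"
    show "f x \<le> g x"
    proof (rule ccontr)
      assume "\<not> f x \<le> g x"
      then have "x \<in> A" using x by (auto simp: A_def)
      then have "f x - g x = 0" using x by simp
      then show False using \<open>\<not> f x \<le> g x\<close>
        by (metis diff_eq_0_iff_ennreal ennreal_minus_eq_0 linorder_not_le)
    qed
  qed
qed


text \<open>The function h is the conditional probability of e \<le> q given the value of f. It is
  the Radon-Nikodym density of the law of f restricted to the event e \<le> q, which is dominated by
  the full law of f.\<close>

lemma conditional_density:
  fixes M :: "'a measure" and N :: "'b measure" and e :: "'a \<Rightarrow> real"
  assumes M: "prob_space M" and [measurable]: "f \<in> M \<rightarrow>\<^sub>M N" "e \<in> borel_measurable M"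
  obtains h where "h \<in> borel_measurable N"
    "\<And>S. S \<in> sets N \<Longrightarrow> (\<integral>\<^sup>+y. h y * indicator S y \<partial>distr M N f) = emeasure M {x\<in>space M. f x \<in> S \<and> e x \<le> q}"
proof -
  interpret prob_space M by fact
  let ?\<nu> = "distr M N f"
  interpret \<nu>: prob_space ?\<nu> by (rule prob_space_distr) simp
  define \<nu>q where "\<nu>q = distr (density M (indicator {x\<in>space M. e x \<le> q})) N f"
  have \<nu>q: "emeasure \<nu>q S = emeasure M {x\<in>space M. f x \<in> S \<and> e x \<le> q}" if [measurable]: "S \<in> sets N" for S
  proof -
    have "emeasure \<nu>q S = emeasure (density M (indicator {x\<in>space M. e x \<le> q})) (f -` S \<inter> space M)"
      unfolding \<nu>q_def by (subst emeasure_distr) auto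
    also have "\<dots> = (\<integral>\<^sup>+x. indicator {x\<in>space M. e x \<le> q} x * indicator (f -` S \<inter> space M) x \<partial>M)"
      by (subst emeasure_density) auto
    also have "\<dots> = (\<integral>\<^sup>+x. indicator {x\<in>space M. f x \<in> S \<and> e x \<le> q} x \<partial>M)"
      by (intro nn_integral_cong) (auto simp: indicator_def)
    also have "\<dots> = emeasure M {x\<in>space M. f x \<in> S \<and> e x \<le> q}" by (subst nn_integral_indicator) auto
    finally show ?thesis .
  qed
  have sets: "sets \<nu>q = sets ?\<nu>" by (simp add: \<nu>q_def)
  have "absolutely_continuous ?\<nu> \<nu>q"
    unfolding absolutely_continuous_def
  proof
    fix S assume S: "S \<in> null_sets ?\<nu>"
    then have [measurable]: "S \<in> sets N" by auto
    have "emeasure \<nu>q S \<le> emeasure M (f -` S \<inter> space M)"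
      unfolding \<nu>q[OF \<open>S \<in> sets N\<close>] by (intro emeasure_mono) auto
    also have "\<dots> = 0" using S by (auto simp: null_sets_def emeasure_distr)
    finally show "S \<in> null_sets \<nu>q" using sets by (auto simp: null_sets_def)
  qed
  from \<nu>.density_RN_deriv[OF this sets] have dens: "density ?\<nu> (RN_deriv ?\<nu> \<nu>q) = \<nu>q" .
  show ?thesis
  proof (rule that[of "RN_deriv ?\<nu> \<nu>q"])
    show "RN_deriv ?\<nu> \<nu>q \<in> borel_measurable N"
      using borel_measurable_RN_deriv[of ?\<nu> \<nu>q] by simp
    fix S assume S: "S \<in> sets N"
    have "emeasure \<nu>q S = (\<integral>\<^sup>+y. RN_deriv ?\<nu> \<nu>q y * indicator S y \<partial>?\<nu>)"
      using S by (subst dens[symmetric], subst emeasure_density) auto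
    then show "(\<integral>\<^sup>+y. RN_deriv ?\<nu> \<nu>q y * indicator S y \<partial>?\<nu>) = emeasure M {x\<in>space M. f x \<in> S \<and> e x \<le> q}"
      using \<nu>q[OF S] by simp
  qed
qed

text \<open>The strict inequality under the infimum gives right-continuity: a rational q > a with
  \<open>H q\<close> close to \<open>F a\<close> bounds \<open>F\<close> on the whole interval
  between a and q. At a rational t the value \<open>F t\<close> may exceed \<open>H t\<close>; only
  the limits at both ends are inherited.\<close>

lemma real_distribution_INF_rat:
  fixes H :: "rat \<Rightarrow> real" and F :: "real \<Rightarrow> real"
  assumes mono: "\<And>q r. q \<le> r \<Longrightarrow> H q \<le> H r" and nn: "\<And>q. 0 \<le> H q"
    and top: "(\<lambda>n. H (of_nat n)) \<longlonglongrightarrow> 1" and bot: "(\<lambda>n. H (- of_nat n)) \<longlonglongrightarrow> 0"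
  defines "F \<equiv> \<lambda>t. INF q\<in>{q. t < of_rat q}. H q"
  shows "real_distribution (interval_measure F)" "emeasure (interval_measure F) {..t} = F t"
proof -
  have ne: "{q. t < of_rat q} \<noteq> {}" for t :: real
    using of_rat_dense[of t "t + 1"] by auto
  have bdd: "bdd_below (H ` A)" for A using nn by (auto intro!: bdd_belowI[of _ 0])
  have F_le: "F t \<le> H q" if "t < of_rat q" for t q
    unfolding F_def by (rule cINF_lower[OF bdd]) (use that in simp)
  have le_F: "H q \<le> F t" if "of_rat q \<le> t" for t q
    unfolding F_def
    by (rule cINF_greatest[OF ne]) (use that in \<open>auto intro!: mono simp: of_rat_less_eq[where 'a = real, symmetric]\<close>)
  have F_mono: "F s \<le> F t" if "s \<le> t" for s t
    unfolding F_def using that by (intro cINF_superset_mono ne bdd) auto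
  have F_right: "continuous (at_right a) F" for a
    unfolding continuous_within
  proof (rule tendstoI)
    fix \<epsilon> :: real assume "\<epsilon> > 0"
    have "F a < F a + \<epsilon>" using \<open>\<epsilon> > 0\<close> by simp
    then obtain q where q: "a < of_rat q" "H q < F a + \<epsilon>"
      unfolding F_def by (subst (asm) cINF_less_iff[OF ne bdd]) auto
    have "dist (F x) (F a) < \<epsilon>" if "a < x" "x < of_rat q" for x
      using F_mono[of a x] F_le[of x q] that q(2) by (auto simp: dist_real_def)
    then show "\<forall>\<^sub>F x in at_right a. dist (F x) (F a) < \<epsilon>"
      unfolding eventually_at_right[OF q(1)] using q(1) by blast
  qed
  have F_nn: "0 \<le> F t" for t unfolding F_def by (rule cINF_greatest[OF ne]) (rule nn)
  have F_1: "F t \<le> 1" for t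
  proof -
    obtain n where "t < real n" using reals_Archimedean2 by blast
    then have "F t \<le> H (of_nat n)" by (intro F_le) simp
    also have "H (of_nat n) \<le> 1"
      by (rule incseq_le[OF _ top]) (auto simp: incseq_def intro: mono)
    finally show ?thesis .
  qed
  have F_top: "(F \<longlongrightarrow> 1) at_top"
  proof (rule tendstoI)
    fix \<epsilon> :: real assume "\<epsilon> > 0"
    then have "\<forall>\<^sub>F n in sequentially. dist (H (of_nat n)) 1 < \<epsilon>" using top by (rule tendstoD[rotated])
    then obtain n where n: "dist (H (of_nat n)) 1 < \<epsilon>" by (auto simp: eventually_sequentially)
    show "\<forall>\<^sub>F x in at_top. dist (F x) 1 < \<epsilon>"
      using eventually_ge_at_top[of "real n"]
    proof eventually_elim
      case (elim x)
      then show ?case using le_F[of "of_nat n" x] F_1[of x] n by (auto simp: dist_real_def)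
    qed
  qed
  have F_bot: "(F \<longlongrightarrow> 0) at_bot"
  proof (rule tendstoI)
    fix \<epsilon> :: real assume "\<epsilon> > 0"
    then have "\<forall>\<^sub>F n in sequentially. dist (H (- of_nat n)) 0 < \<epsilon>" using bot by (rule tendstoD[rotated])
    then obtain n where n: "dist (H (- of_nat n)) 0 < \<epsilon>" by (auto simp: eventually_sequentially)
    show "\<forall>\<^sub>F x in at_bot. dist (F x) 0 < \<epsilon>"
    proof -
      have "\<forall>\<^sub>F x in at_bot. x < - real n" by (auto simp: eventually_at_bot_dense)
      then show ?thesis
      proof eventually_elim
        case (elim x)
        then show ?case using F_le[of x "- of_nat n"] F_nn[of x] n by (auto simp: dist_real_def of_rat_minus)
      qed
    qed
  qed
  show "real_distribution (interval_measure F)"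
    by (rule real_distribution_interval_measure[OF F_mono F_right F_bot F_top])
  show "emeasure (interval_measure F) {..t} = F t"
    by (rule emeasure_interval_measure_Iic[OF F_mono F_right F_bot])
qed

text \<open>
  Taking infima over rational levels makes the conditional distribution function right-continuous,
  at the price of redefining it on a null set of conditions.
\<close>

lemma conditional_kernel:
  fixes M :: "'a measure" and N :: "'b measure" and e :: "'a \<Rightarrow> real"
  assumes M: "prob_space M" and f [measurable]: "f \<in> M \<rightarrow>\<^sub>M N" and e [measurable]: "e \<in> borel_measurable M"
  obtains K where "K \<in> N \<rightarrow>\<^sub>M prob_algebra borel"
    "\<And>W. W \<in> sets (N \<Otimes>\<^sub>M borel) \<Longrightarrow> emeasure M {x\<in>space M. (f x, e x) \<in> W} =
      (\<integral>\<^sup>+y. emeasure (K y) (Pair y -` W) \<partial>distr M N f)"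
proof -
  interpret prob_space M by fact
  define \<nu> where "\<nu> = distr M N f"
  interpret \<nu>: prob_space \<nu> unfolding \<nu>_def by (rule prob_space_distr) simp
  have sets_\<nu> [measurable_cong]: "sets \<nu> = sets N" and space_\<nu>: "space \<nu> = space N" by (auto simp: \<nu>_def)
  define J where "J S q = emeasure M {x\<in>space M. f x \<in> S \<and> e x \<le> q}" for S q
  have "\<exists>h. h \<in> borel_measurable N \<and> (\<forall>S\<in>sets N. (\<integral>\<^sup>+y. h y * indicator S y \<partial>\<nu>) = J S q)" for q
    unfolding \<nu>_def J_def by (rule conditional_density[OF M f e, of q]) blast
  then obtain h where h [measurable]: "\<And>q. h q \<in> borel_measurable N"
    and hJ: "\<And>q S. S \<in> sets N \<Longrightarrow> (\<integral>\<^sup>+y. h q y * indicator S y \<partial>\<nu>) = J S q"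
    by metis
  have int_h: "(\<integral>\<^sup>+y. h q y \<partial>\<nu>) \<noteq> \<infinity>" for q
  proof -
    have "(\<integral>\<^sup>+y. h q y \<partial>\<nu>) = (\<integral>\<^sup>+y. h q y * indicator (space N) y \<partial>\<nu>)"
      by (intro nn_integral_cong) (auto simp: space_\<nu>)
    then show ?thesis by (simp add: hJ J_def)
  qed
  have J_1: "(\<integral>\<^sup>+y. 1 * indicator S y \<partial>\<nu>) = emeasure M {x\<in>space M. f x \<in> S}"
    if [measurable]: "S \<in> sets N" for S
  proof -
    have "(\<integral>\<^sup>+y. 1 * indicator S y \<partial>\<nu>) = emeasure \<nu> S" by simp
    also have "\<dots> = emeasure M (f -` S \<inter> space M)" unfolding \<nu>_def by (simp add: emeasure_distr)
    also have "f -` S \<inter> space M = {x\<in>space M. f x \<in> S}" by auto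
    finally show ?thesis .
  qed
  have h_mono: "AE y in \<nu>. h q y \<le> h r y" if "q \<le> r" for q r
  proof (rule AE_le_if_set_nn_integral_le)
    fix A assume "A \<in> sets \<nu>"
    then have [measurable]: "A \<in> sets N" by (simp add: sets_\<nu>)
    show "(\<integral>\<^sup>+y. h q y * indicator A y \<partial>\<nu>) \<le> (\<integral>\<^sup>+y. h r y * indicator A y \<partial>\<nu>)"
      using that by (simp add: hJ J_def) (intro emeasure_mono, auto)
  qed (use int_h in auto)
  have h_le_1: "AE y in \<nu>. h q y \<le> 1" for q
  proof (rule AE_le_if_set_nn_integral_le)
    fix A assume "A \<in> sets \<nu>"
    then have [measurable]: "A \<in> sets N" by (simp add: sets_\<nu>)
    show "(\<integral>\<^sup>+y. h q y * indicator A y \<partial>\<nu>) \<le> (\<integral>\<^sup>+y. 1 * indicator A y \<partial>\<nu>)"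
      unfolding J_1[OF \<open>A \<in> sets N\<close>] hJ[OF \<open>A \<in> sets N\<close>] J_def by (intro emeasure_mono) auto
  qed auto
  have h_top: "AE y in \<nu>. 1 \<le> (SUP n. h (real n) y)"
  proof (rule AE_le_if_set_nn_integral_le)
    have "AE y in \<nu>. (SUP n. h (real n) y) \<le> 1"
      using AE_all_countable[THEN iffD2, OF allI, OF h_le_1[of "real n" for n]]
      by eventually_elim (auto intro: SUP_least)
    then have "(\<integral>\<^sup>+y. (SUP n. h (real n) y) \<partial>\<nu>) \<le> (\<integral>\<^sup>+y. 1 \<partial>\<nu>)" by (rule nn_integral_mono_AE)
    then show "(\<integral>\<^sup>+y. (SUP n. h (real n) y) \<partial>\<nu>) \<noteq> \<infinity>" using \<nu>.emeasure_space_1 by (auto simp: top_unique)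
    fix A assume "A \<in> sets \<nu>"
    then have A [measurable]: "A \<in> sets N" by (simp add: sets_\<nu>)
    have "{x\<in>space M. f x \<in> A} = (\<Union>n. {x\<in>space M. f x \<in> A \<and> e x \<le> real n})"
      by (auto intro: real_arch_simple)
    then have "emeasure M {x\<in>space M. f x \<in> A} = (SUP n. J A (real n))"
      unfolding J_def by (simp add: SUP_emeasure_incseq[symmetric] incseq_def le_fun_def)
        (subst SUP_emeasure_incseq, auto simp: incseq_def)
    also have "\<dots> \<le> (\<integral>\<^sup>+y. (SUP n. h (real n) y) * indicator A y \<partial>\<nu>)"
      unfolding hJ[OF A, symmetric] by (intro SUP_least nn_integral_mono mult_right_mono SUP_upper) auto
    finally show "(\<integral>\<^sup>+y. 1 * indicator A y \<partial>\<nu>) \<le> (\<integral>\<^sup>+y. (SUP n. h (real n) y) * indicator A y \<partial>\<nu>)"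
      using J_1[OF A] by simp
  qed auto
  \<comment> \<open>Common core of two limits: levels tending to minus infinity, with bound 0, and
    levels tending to t from above, with bound the density at t. In both cases continuity from above
    of the joint law gives the assumed inequality.\<close>
  have h_INF: "AE y in \<nu>. (INF n. h (q n) y) \<le> g y"
    if g [measurable]: "g \<in> borel_measurable N" "(\<integral>\<^sup>+y. g y \<partial>\<nu>) \<noteq> \<infinity>"
      and lim: "\<And>A. A \<in> sets N \<Longrightarrow> (INF n. J A (q n)) \<le> (\<integral>\<^sup>+y. g y * indicator A y \<partial>\<nu>)"
    for q :: "nat \<Rightarrow> real" and g
  proof (rule AE_le_if_set_nn_integral_le)
    fix A assume "A \<in> sets \<nu>"
    then have A [measurable]: "A \<in> sets N" by (simp add: sets_\<nu>)
    have "(\<integral>\<^sup>+y. (INF n. h (q n) y) * indicator A y \<partial>\<nu>) \<le> (INF n. J A (q n))"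
      unfolding hJ[OF A, symmetric] by (intro INF_greatest nn_integral_mono mult_right_mono INF_lower) auto
    also note lim[OF A]
    finally show "(\<integral>\<^sup>+y. (INF n. h (q n) y) * indicator A y \<partial>\<nu>) \<le> (\<integral>\<^sup>+y. g y * indicator A y \<partial>\<nu>)" .
  qed (use g(2) in auto)
  have h_bot: "AE y in \<nu>. (INF n. h (- real n) y) \<le> 0"
  proof (rule h_INF)
    fix A assume [measurable]: "A \<in> sets N"
    have "(INF n. J A (- real n)) = emeasure M (\<Inter>n. {x\<in>space M. f x \<in> A \<and> e x \<le> - real n})"
      unfolding J_def by (rule INF_emeasure_decseq) (auto simp: decseq_def)
    also have "(\<Inter>n. {x\<in>space M. f x \<in> A \<and> e x \<le> - real n}) = {}"
    proof -
      have "\<exists>n. \<not> e x \<le> - real n" for x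
        using reals_Archimedean2[of "- e x"] by (auto simp: not_le minus_less_iff)
      then show ?thesis by blast
    qed
    finally show "(INF n. J A (- real n)) \<le> (\<integral>\<^sup>+y. 0 * indicator A y \<partial>\<nu>)" by simp
  qed auto
  \<comment> \<open>Restricting monotonicity and the bound by 1 to rational levels leaves countably
    many almost-sure conditions, which hold simultaneously on a conull set.\<close>
  define G where "G = {y\<in>space N. (\<forall>q r::rat. q \<le> r \<longrightarrow> h (of_rat q) y \<le> h (of_rat r) y) \<and>
    (\<forall>q::rat. h (of_rat q) y \<le> 1) \<and> 1 \<le> (SUP n. h (real n) y) \<and> (INF n. h (- real n) y) \<le> 0}"
  have G [measurable]: "G \<in> sets N" unfolding G_def by measurable
  have AE_G: "AE y in \<nu>. y \<in> G"
  proof -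
    have "AE y in \<nu>. \<forall>q r::rat. q \<le> r \<longrightarrow> h (of_rat q) y \<le> h (of_rat r) y"
      unfolding AE_all_countable
      by (intro allI) (rule AE_impI, rule h_mono, simp add: of_rat_less_eq)
    moreover have "AE y in \<nu>. \<forall>q::rat. h (of_rat q) y \<le> 1"
      unfolding AE_all_countable by (intro allI h_le_1)
    moreover note h_top h_bot AE_space[of \<nu>]
    ultimately show ?thesis by eventually_elim (auto simp: G_def space_\<nu>)
  qed
  \<comment> \<open>Outside \<open>G\<close> the values are those of the point mass at 0, so that
    \<open>K y\<close> is a probability measure for every y.\<close>
  define H where "H q y = (if y \<in> G then enn2real (h (of_rat q) y) else if 0 \<le> q then 1 else 0)" for q :: rat and y
  have H_meas [measurable]: "H q \<in> borel_measurable N" for q unfolding H_def by measurable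
  have H_eq: "ennreal (H q y) = h (of_rat q) y" if "y \<in> G" for q y
    using that by (auto simp: H_def G_def intro!: ennreal_enn2real)
      (metis ennreal_one_less_top le_less_trans)
  have H_nn: "0 \<le> H q y" for q y by (simp add: H_def)
  have H_mono: "H q y \<le> H r y" if "q \<le> r" for q r y
  proof (cases "y \<in> G")
    case True
    then have "ennreal (H q y) \<le> ennreal (H r y)" unfolding H_eq[OF True] using that by (simp add: G_def)
    then show ?thesis using H_nn by simp
  qed (use that in \<open>auto simp: H_def\<close>)
  have H_top: "(\<lambda>n. H (of_nat n) y) \<longlonglongrightarrow> 1" for y
  proof (cases "y \<in> G")
    case True
    have "(SUP n. h (real n) y) \<le> 1"
      using True by (intro SUP_least) (auto simp: G_def dest!: spec[where x = "of_nat _"])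
    with True have "(SUP n. h (real n) y) = 1" by (auto simp: G_def intro: antisym)
    moreover have "incseq (\<lambda>n. ennreal (H (of_nat n) y))"
      by (auto simp: incseq_def intro!: ennreal_leI H_mono)
    ultimately have "(\<lambda>n. ennreal (H (of_nat n) y)) \<longlonglongrightarrow> ennreal 1"
      using LIMSEQ_SUP by (fastforce simp: H_eq[OF True])
    then show ?thesis by (subst (asm) tendsto_ennreal_iff) (auto simp: H_nn)
  qed (simp add: H_def)
  have H_bot: "(\<lambda>n. H (- of_nat n) y) \<longlonglongrightarrow> 0" for y
  proof (cases "y \<in> G")
    case True
    then have "(INF n. h (- real n) y) = 0" by (auto simp: G_def)
    moreover have "decseq (\<lambda>n. ennreal (H (- of_nat n) y))"
      by (auto simp: decseq_def intro!: ennreal_leI H_mono)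
    ultimately have "(\<lambda>n. ennreal (H (- of_nat n) y)) \<longlonglongrightarrow> ennreal 0"
      using LIMSEQ_INF by (fastforce simp: H_eq[OF True] of_rat_minus)
    then show ?thesis by (subst (asm) tendsto_ennreal_iff) (auto simp: H_nn)
  next
    case False
    have "\<forall>\<^sub>F n in sequentially. H (- of_nat n) y = 0"
      using eventually_gt_at_top[of "0::nat"] by eventually_elim (simp add: H_def False)
    then show ?thesis by (rule tendsto_eventually)
  qed
  define F where "F y t = (INF q\<in>{q. t < of_rat q}. H q y)" for y and t :: real
  define K where "K y = interval_measure (F y)" for y
  have K_dist: "real_distribution (K y)" for y
    unfolding K_def F_def by (rule real_distribution_INF_rat(1)[OF H_mono H_nn H_top H_bot])
  have K_Iic: "emeasure (K y) {..t} = F y t" for y t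
    unfolding K_def F_def by (rule real_distribution_INF_rat(2)[OF H_mono H_nn H_top H_bot])
  have F_meas [measurable]: "(\<lambda>y. F y t) \<in> borel_measurable N" for t
    unfolding F_def by (rule borel_measurable_cINF_real) auto
  have K [measurable]: "K \<in> N \<rightarrow>\<^sub>M prob_algebra borel"
  proof (rule measurable_prob_algebra_generated)
    show "sets borel = sigma_sets (UNIV :: real set) (range atMost)"
      by (subst borel_eq_atMost) simp
    show "Int_stable (range (atMost :: real \<Rightarrow> real set))"
      by (auto simp: Int_stable_def)
    show "prob_space (K y)" "sets (K y) = sets borel" for y
      using K_dist[of y] by (auto simp: real_distribution_def real_distribution_axioms_def)
    show "(\<lambda>y. emeasure (K y) A) \<in> borel_measurable N" if "A \<in> range atMost" for A :: "real set"
      using that by (auto simp: K_Iic)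
  qed auto
  \<comment> \<open>Although \<open>F\<close> is built from rational levels, at each real t it
    agrees almost everywhere with the density: rationals tending to t from above bound it from
    above, monotonicity of the densities from below. The null set depends on t, which suffices since
    \<open>rect\<close> compares measures at one t at a time.\<close>
  have F_h: "AE y in \<nu>. ennreal (F y t) = h t y" for t
  proof -
    have "\<forall>n. \<exists>q. t < of_rat q \<and> of_rat q < t + 1 / Suc n"
      by (auto intro: of_rat_dense)
    then obtain q where q: "\<And>n. t < of_rat (q n)" "\<And>n. of_rat (q n) < t + 1 / Suc n" by metis
    have "AE y in \<nu>. (INF n. h (of_rat (q n)) y) \<le> h t y"
    proof (rule h_INF)
      fix A assume A [measurable]: "A \<in> sets N"
      have "(INF n. J A (of_rat (q n))) \<le> (INF n. J A (t + 1 / Suc n))"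
        using q(2) unfolding J_def by (intro INF_mono bexI emeasure_mono) (auto intro: less_imp_le order_trans)
      also have "\<dots> = emeasure M (\<Inter>n. {x\<in>space M. f x \<in> A \<and> e x \<le> t + 1 / Suc n})"
        unfolding J_def
      proof (rule INF_emeasure_decseq)
        show "decseq (\<lambda>n. {x\<in>space M. f x \<in> A \<and> e x \<le> t + 1 / Suc n})"
        proof (rule decseq_SucI)
          fix n
          have "1 / real (Suc (Suc n)) \<le> 1 / Suc n" by (simp add: frac_le)
          then show "{x\<in>space M. f x \<in> A \<and> e x \<le> t + 1 / Suc (Suc n)} \<subseteq> {x\<in>space M. f x \<in> A \<and> e x \<le> t + 1 / Suc n}"
            by (auto simp del: of_nat_Suc)
        qed
      qed auto
      also have "(\<Inter>n. {x\<in>space M. f x \<in> A \<and> e x \<le> t + 1 / Suc n}) = {x\<in>space M. f x \<in> A \<and> e x \<le> t}"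
      proof -
        have "e x \<le> t" if "\<forall>n. e x \<le> t + 1 / Suc n" for x
        proof (rule field_le_epsilon)
          fix \<epsilon> :: real assume "\<epsilon> > 0"
          then obtain n where "1 / Suc n < \<epsilon>" using nat_approx_posE by blast
          then show "e x \<le> t + \<epsilon>" using that[rule_format, of n] by simp
        qed
        then show ?thesis by (auto simp del: of_nat_Suc intro: add_increasing2)
      qed
      finally show "(INF n. J A (of_rat (q n))) \<le> (\<integral>\<^sup>+y. h t y * indicator A y \<partial>\<nu>)"
        unfolding hJ[OF A] by (simp add: J_def)
    qed (use int_h in auto)
    moreover have "AE y in \<nu>. \<forall>r\<in>{r::rat. t < of_rat r}. h t y \<le> h (of_rat r) y"
      by (subst AE_ball_countable) (auto intro: h_mono)
    ultimately show ?thesis using AE_G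
    proof eventually_elim
      case (elim y)
      have ne: "{r::rat. t < of_rat r} \<noteq> {}" using q(1) by auto
      have bdd: "bdd_below ((\<lambda>r. H r y) ` A)" for A by (auto intro!: bdd_belowI[of _ 0] H_nn)
      have "ennreal (F y t) \<le> (INF n. h (of_rat (q n)) y)"
        unfolding H_eq[OF elim(3), symmetric] F_def
        by (intro INF_greatest ennreal_leI cINF_lower bdd) (use q(1) in auto)
      also note elim(1)
      finally have le: "ennreal (F y t) \<le> h t y" .
      have "h t y \<le> h (of_rat (q 0)) y" using elim(2) q(1) by auto
      then have "h t y < \<top>"
        unfolding H_eq[OF elim(3), symmetric] by (rule le_less_trans) (rule ennreal_less_top)
      then have fin: "h t y = ennreal (enn2real (h t y))" by simp
      have "enn2real (h t y) \<le> F y t"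
        unfolding F_def
      proof (rule cINF_greatest[OF ne])
        fix r assume "r \<in> {r::rat. t < of_rat r}"
        then have "ennreal (enn2real (h t y)) \<le> ennreal (H r y)"
          using elim(2) fin H_eq[OF elim(3)] by auto
        then show "enn2real (h t y) \<le> H r y" using H_nn by simp
      qed
      then show ?case using le fin by (metis antisym ennreal_leI)
    qed
  qed
  \<comment> \<open>With \<open>S\<close> fixed, both sides are finite measures in \<open>A\<close>.
    They agree on the half-lines by \<open>F_h\<close>, and these form an intersection-stable
    generator.\<close>
  have rect: "emeasure M {x\<in>space M. f x \<in> S \<and> e x \<in> A} = (\<integral>\<^sup>+y. emeasure (K y) A * indicator S y \<partial>\<nu>)"
    if S [measurable]: "S \<in> sets N" and A [measurable]: "A \<in> sets borel" for S A
  proof -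
    define m1 where "m1 = distr (density M (indicator {x\<in>space M. f x \<in> S})) borel e"
    define m2 where "m2 = density \<nu> (indicator S) \<bind> K"
    have m1: "emeasure m1 A = emeasure M {x\<in>space M. f x \<in> S \<and> e x \<in> A}"
      if [measurable]: "A \<in> sets borel" for A
    proof -
      have "emeasure m1 A = (\<integral>\<^sup>+x. indicator {x\<in>space M. f x \<in> S} x * indicator (e -` A \<inter> space M) x \<partial>M)"
        unfolding m1_def by (subst emeasure_distr) (auto simp: emeasure_density)
      also have "\<dots> = (\<integral>\<^sup>+x. indicator {x\<in>space M. f x \<in> S \<and> e x \<in> A} x \<partial>M)"
        by (intro nn_integral_cong) (auto simp: indicator_def)
      finally show ?thesis by (simp add: nn_integral_indicator)
    qed
    have m2: "emeasure m2 A = (\<integral>\<^sup>+y. emeasure (K y) A * indicator S y \<partial>\<nu>)"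
      if [measurable]: "A \<in> sets borel" for A
    proof -
      have "emeasure m2 A = (\<integral>\<^sup>+y. emeasure (K y) A \<partial>density \<nu> (indicator S))"
        unfolding m2_def
        using measurable_prob_algebraD[OF K] that \<nu>.not_empty
        by (intro emeasure_bind[where N = borel]) auto
      also have "\<dots> = (\<integral>\<^sup>+y. indicator S y * emeasure (K y) A \<partial>\<nu>)"
        using measurable_compose[OF measurable_prob_algebraD[OF K] measurable_emeasure_subprob_algebra[OF that]]
        by (intro nn_integral_density) auto
      finally show ?thesis by (simp add: mult.commute)
    qed
    have sets_m2: "sets m2 = sets borel"
      unfolding m2_def using \<nu>.not_empty K_dist
      by (intro sets_bind) (auto simp: real_distribution_def real_distribution_axioms_def)
    have "m1 = m2"
    proof (rule measure_eqI_generator_eq[where E = "range atMost" and \<Omega> = UNIV and A = "\<lambda>n. {..real n}"])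
      show "Int_stable (range (atMost :: real \<Rightarrow> real set))" by (auto simp: Int_stable_def)
      show "sets m1 = sigma_sets UNIV (range atMost)" "sets m2 = sigma_sets UNIV (range atMost)"
        unfolding sets_m2 by (simp_all add: m1_def borel_eq_atMost)
      show "(\<Union>n. {..real n}) = UNIV" using real_arch_simple by auto
      show "emeasure m1 {..real n} \<noteq> \<infinity>" for n by (simp add: m1)
      fix X :: "real set" assume "X \<in> range atMost"
      then obtain t where X: "X = {..t}" by auto
      have "emeasure m2 X = (\<integral>\<^sup>+y. h t y * indicator S y \<partial>\<nu>)"
        unfolding X m2[OF borel_closed[OF closed_atMost]] K_Iic
        using F_h[of t] by (intro nn_integral_cong_AE) auto
      then show "emeasure m1 X = emeasure m2 X" by (simp add: hJ J_def X m1)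
    qed auto
    then show ?thesis using m1[OF A] m2[OF A] by simp
  qed
  \<comment> \<open>The same uniqueness argument, now on rectangles, passes from \<open>rect\<close>
    to arbitrary measurable sets of the product.\<close>
  define J1 where "J1 = distr M (N \<Otimes>\<^sub>M borel) (\<lambda>x. (f x, e x))"
  define J2 where "J2 = \<nu> \<bind> (\<lambda>y. distr (K y) (N \<Otimes>\<^sub>M borel) (Pair y))"
  have sets_K: "sets (K y) = sets borel" for y
    using K_dist[of y] by (auto simp: real_distribution_def real_distribution_axioms_def)
  have J2: "emeasure J2 W = (\<integral>\<^sup>+y. emeasure (K y) (Pair y -` W) \<partial>\<nu>)"
    if W [measurable]: "W \<in> sets (N \<Otimes>\<^sub>M borel)" for W
  proof -
    have "emeasure J2 W = (\<integral>\<^sup>+y. emeasure (distr (K y) (N \<Otimes>\<^sub>M borel) (Pair y)) W \<partial>\<nu>)"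
      unfolding J2_def
    proof (rule emeasure_bind[OF \<nu>.not_empty _ W])
      have "(\<lambda>y. distr (K y) (N \<Otimes>\<^sub>M borel) (Pair y)) \<in> N \<rightarrow>\<^sub>M subprob_algebra (N \<Otimes>\<^sub>M borel)"
        by (rule measurable_distr2[where M = borel]) (auto intro: measurable_prob_algebraD[OF K])
      then show "(\<lambda>y. distr (K y) (N \<Otimes>\<^sub>M borel) (Pair y)) \<in> \<nu> \<rightarrow>\<^sub>M subprob_algebra (N \<Otimes>\<^sub>M borel)"
        by simp
    qed
    also have "\<dots> = (\<integral>\<^sup>+y. emeasure (K y) (Pair y -` W) \<partial>\<nu>)"
    proof (rule nn_integral_cong)
      fix y assume "y \<in> space \<nu>"
      then have "Pair y \<in> K y \<rightarrow>\<^sub>M N \<Otimes>\<^sub>M borel"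
        by (simp add: measurable_cong_sets[OF sets_K refl] space_\<nu>)
      then show "emeasure (distr (K y) (N \<Otimes>\<^sub>M borel) (Pair y)) W = emeasure (K y) (Pair y -` W)"
        using sets_eq_imp_space_eq[OF sets_K[of y]] by (simp add: emeasure_distr)
    qed
    finally show ?thesis .
  qed
  have "J1 = J2"
  proof (rule measure_eqI_generator_eq[where E = "{a \<times> b |a b. a \<in> sets N \<and> b \<in> sets borel}"
        and \<Omega> = "space N \<times> (UNIV :: real set)" and A = "\<lambda>_. space N \<times> UNIV"])
    show "Int_stable {a \<times> b |a b. a \<in> sets N \<and> b \<in> sets (borel :: real measure)}"
      by (rule Int_stable_pair_measure_generator)
    show "{a \<times> b |a b. a \<in> sets N \<and> b \<in> sets borel} \<subseteq> Pow (space N \<times> (UNIV :: real set))"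
      using pair_measure_closed[of N "borel :: real measure"] by simp
    show "sets J1 = sigma_sets (space N \<times> UNIV) {a \<times> b |a b. a \<in> sets N \<and> b \<in> sets borel}"
      by (simp add: J1_def sets_pair_measure)
    show "sets J2 = sigma_sets (space N \<times> UNIV) {a \<times> b |a b. a \<in> sets N \<and> b \<in> sets borel}"
      unfolding J2_def by (subst sets_bind[where N = "N \<Otimes>\<^sub>M borel"]) (auto simp: \<nu>.not_empty sets_pair_measure)
    show "emeasure J1 (space N \<times> UNIV) \<noteq> \<infinity>" for i :: nat
      unfolding J1_def by (subst emeasure_distr) auto
    fix X assume "X \<in> {a \<times> b |a b. a \<in> sets N \<and> b \<in> sets (borel :: real measure)}"
    then obtain S A where X: "X = S \<times> A" and SA [measurable]: "S \<in> sets N" "A \<in> sets borel" by auto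
    have "emeasure J1 X = emeasure M {x\<in>space M. f x \<in> S \<and> e x \<in> A}"
      unfolding J1_def X by (subst emeasure_distr) (auto intro!: arg_cong[where f = "emeasure M"])
    also have "\<dots> = (\<integral>\<^sup>+y. emeasure (K y) (Pair y -` X) \<partial>\<nu>)"
      unfolding rect[OF SA] X by (intro nn_integral_cong) (auto simp: indicator_def vimage_def)
    also have "\<dots> = emeasure J2 X" unfolding X by (subst J2) auto
    finally show "emeasure J1 X = emeasure J2 X" .
  next
    show "range (\<lambda>_. space N \<times> UNIV) \<subseteq> {a \<times> b |a b. a \<in> sets N \<and> b \<in> sets (borel :: real measure)}"
      by (rule image_subsetI, rule CollectI, intro exI conjI, rule refl) auto
  qed auto
  show ?thesis
  proof (rule that[OF K])
    fix W assume W [measurable]: "W \<in> sets (N \<Otimes>\<^sub>M (borel :: real measure))"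
    have "emeasure M {x\<in>space M. (f x, e x) \<in> W} = emeasure J1 W"
      unfolding J1_def by (subst emeasure_distr) (auto intro!: arg_cong[where f = "emeasure M"])
    then show "emeasure M {x\<in>space M. (f x, e x) \<in> W} = (\<integral>\<^sup>+y. emeasure (K y) (Pair y -` W) \<partial>distr M N f)"
      using J2[OF W] \<open>J1 = J2\<close> by (simp add: \<nu>_def)
  qed
qed

section \<open>Atoms of conditional distributions and finite-to-one pieces\<close>

lemma (in prob_space) finite_large_atoms:
  assumes "\<epsilon> > 0" and sing: "\<And>x. x \<in> space M \<Longrightarrow> {x} \<in> sets M"
  shows "finite {x\<in>space M. ennreal \<epsilon> \<le> emeasure M {x}}" (is "finite ?A")
proof (rule ccontr)
  assume "infinite ?A"
  obtain n :: nat where n: "1 / \<epsilon> < n" using reals_Archimedean2 by blast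
  obtain B where B: "B \<subseteq> ?A" "finite B" "card B = n"
    using infinite_arbitrarily_large[OF \<open>infinite ?A\<close>] by blast
  have "real n * \<epsilon> = (\<Sum>x\<in>B. \<epsilon>)" using B by simp
  also have "\<dots> \<le> (\<Sum>x\<in>B. prob {x})"
    using B(1) by (intro sum_mono) (auto simp: emeasure_eq_measure)
  also have "\<dots> = prob B"
    using B(1,2) by (intro finite_measure_eq_sum_singleton[symmetric]) (auto intro: sing)
  also have "\<dots> \<le> 1" by simp
  finally show False using n \<open>\<epsilon> > 0\<close> by (simp add: field_simps)
qed

text \<open>
  The conditional distributions of \<open>e\<close> given \<open>f\<close> live on countable sets, hence are purely atomic,
  and only finitely many atoms have mass at least \<open>1 / Suc n\<close>.
\<close>

lemma countable_to_one_finite_to_one_pieces: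
  fixes M :: "'a measure" and N :: "'b measure"
  assumes M: "prob_space M" "standard_borel M" and N: "standard_borel N"
    and f [measurable]: "f \<in> M \<rightarrow>\<^sub>M N" and cnt: "\<And>y. y \<in> space N \<Longrightarrow> countable {x\<in>space M. f x = y}"
  obtains D :: "nat \<Rightarrow> 'a set" where "\<And>n. D n \<in> sets M" "incseq D" "space M - (\<Union>n. D n) \<in> null_sets M"
    "\<And>n y. finite {x\<in>D n. f x = y}"
proof -
  interpret prob_space M by fact
  obtain e :: "'a \<Rightarrow> real" where e [measurable]: "e \<in> borel_measurable M" and e_inj: "inj_on e (space M)"
    using standard_borel_real_injection[OF M(2)] by blast
  \<comment> \<open>A real coding of \<open>N\<close> turns the condition f x = y into an equation
    between measurable real functions.\<close>
  obtain e' :: "'b \<Rightarrow> real" where e' [measurable]: "e' \<in> borel_measurable N" and e'_inj: "inj_on e' (space N)"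
    using standard_borel_real_injection[OF N] by blast
  obtain K :: "'b \<Rightarrow> real measure" where K: "K \<in> N \<rightarrow>\<^sub>M prob_algebra borel"
    and law: "\<And>W. W \<in> sets (N \<Otimes>\<^sub>M borel) \<Longrightarrow> emeasure M {x\<in>space M. (f x, e x) \<in> W} =
      (\<integral>\<^sup>+y. emeasure (K y) (Pair y -` W) \<partial>distr M N f)"
    by (rule conditional_kernel[OF M(1) f e]) (rule that)
  note K_sub [measurable] = measurable_prob_algebraD[OF K]
  have prob_K: "prob_space (K y)" and sets_K: "sets (K y) = sets borel" if "y \<in> space N" for y
    using measurable_space[OF K that] by (auto simp: space_prob_algebra)
  let ?\<nu> = "distr M N f" and ?J = "distr M (N \<Otimes>\<^sub>M borel) (\<lambda>x. (f x, e x))"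
  interpret J: prob_space ?J by (rule prob_space_distr) simp
  have J: "emeasure ?J W = emeasure M {x\<in>space M. (f x, e x) \<in> W}" if "W \<in> sets (N \<Otimes>\<^sub>M borel)" for W
    using that by (subst emeasure_distr) (auto intro!: arg_cong[where f = "emeasure M"])

  \<comment> \<open>The image of \<open>(f, e)\<close> contains a conull Borel set.\<close>
  define P where "P = {w \<in> space ((N \<Otimes>\<^sub>M borel) \<Otimes>\<^sub>M M). e' (f (snd w)) = e' (fst (fst w)) \<and> e (snd w) = snd (fst w)}"
  have "P \<in> sets ((N \<Otimes>\<^sub>M borel) \<Otimes>\<^sub>M M)" unfolding P_def by measurable
  then have P: "P \<in> sets (?J \<Otimes>\<^sub>M M)" by (simp cong: sets_pair_measure_cong)
  have P_iff: "((y, z), x) \<in> P \<longleftrightarrow> y \<in> space N \<and> x \<in> space M \<and> f x = y \<and> e x = z" for x y z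
    using measurable_space[OF f] inj_onD[OF e'_inj] by (auto simp: P_def space_pair_measure)
  obtain x0 where x0: "x0 \<in> space M" using not_empty by blast
  \<comment> \<open>The joint law is the base measure and \<open>M\<close> the target. A selected
    preimage certifies that each point of \<open>S\<close> is a value of (f, e), and at most the
    null set \<open>N0\<close> of the image is missed.\<close>
  obtain S N0 s where S': "S \<in> sets ?J" and N0: "N0 \<in> null_sets ?J"
    and s: "\<And>w. w \<in> S \<Longrightarrow> (w, s w) \<in> P" and SN: "\<And>w x. (w, x) \<in> P \<Longrightarrow> w \<in> S \<union> N0"
  proof (rule measurable_selection[OF J.finite_measure_axioms M(2) P])
    show "(\<lambda>_. x0) \<in> ?J \<rightarrow>\<^sub>M M" using x0 by simp
  qed blast
  from S' have S [measurable]: "S \<in> sets (N \<Otimes>\<^sub>M borel)" by simp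
  have "AE w in ?J. w \<notin> N0" using N0 by (rule AE_not_in)
  then have "AE x in M. (f x, e x) \<notin> N0" by (rule AE_distrD[rotated]) simp
  then have "AE x in M. (f x, e x) \<in> S"
  proof (rule AE_mp, intro AE_I2 impI)
    fix x assume x: "x \<in> space M" "(f x, e x) \<notin> N0"
    then have "((f x, e x), x) \<in> P" using measurable_space[OF f] by (auto simp: P_iff)
    then show "(f x, e x) \<in> S" using SN x by blast
  qed
  then have S_1: "emeasure M {x\<in>space M. (f x, e x) \<in> S} = 1"
    by (subst emeasure_eq_1_AE) auto
  have S_countable: "countable (Pair y -` S)" if "y \<in> space N" for y
  proof (rule countable_subset)
    show "Pair y -` S \<subseteq> e ` {x\<in>space M. f x = y}"
    proof
      fix z assume "z \<in> Pair y -` S"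
      then have "((y, z), s (y, z)) \<in> P" using s by simp
      then have "z = e (s (y, z))" "s (y, z) \<in> {x\<in>space M. f x = y}" by (simp_all add: P_iff)
      then show "z \<in> e ` {x\<in>space M. f x = y}" by (rule image_eqI)
    qed
  qed (use cnt[OF that] in auto)

  define a where "a w = emeasure (K (fst w)) {snd w}" for w
  have a [measurable]: "a \<in> borel_measurable (N \<Otimes>\<^sub>M borel)"
  proof -
    have "{u \<in> space ((N \<Otimes>\<^sub>M borel) \<Otimes>\<^sub>M borel). snd (fst u) = snd u} \<in> sets ((N \<Otimes>\<^sub>M borel) \<Otimes>\<^sub>M (borel :: real measure))"
      by measurable
    moreover have "(\<lambda>w. K (fst w)) \<in> N \<Otimes>\<^sub>M borel \<rightarrow>\<^sub>M subprob_algebra (borel :: real measure)" by measurable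
    moreover have "{u \<in> space ((N \<Otimes>\<^sub>M borel) \<Otimes>\<^sub>M borel). snd (fst u) = snd u} =
        (SIGMA w:space (N \<Otimes>\<^sub>M (borel :: real measure)). {snd w})"
      by (auto simp: space_pair_measure)
    ultimately show ?thesis
      unfolding a_def by (intro emeasure_measurable_subprob_algebra2[where N = borel]) simp_all
  qed
  define W where "W = {w \<in> space (N \<Otimes>\<^sub>M borel). a w \<noteq> 0}"
  have W [measurable]: "W \<in> sets (N \<Otimes>\<^sub>M borel)" unfolding W_def by measurable
  \<comment> \<open>Each section of \<open>S\<close> is countable, so its points of conditional mass
    0 carry no mass together. Passing from \<open>S\<close> to the set \<open>W\<close> of points of
    positive mass therefore keeps full measure.\<close>
  have "1 = (\<integral>\<^sup>+y. emeasure (K y) (Pair y -` S) \<partial>?\<nu>)" using law[OF S] S_1 by simp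
  also have "\<dots> \<le> (\<integral>\<^sup>+y. emeasure (K y) (Pair y -` W) \<partial>?\<nu>)"
  proof (rule nn_integral_mono)
    fix y assume "y \<in> space ?\<nu>"
    then have y: "y \<in> space N" by simp
    have sec: "Pair y -` A \<in> sets (K y)" if "A \<in> sets (N \<Otimes>\<^sub>M borel)" for A
      using sets_Pair1[OF that] by (simp add: sets_K[OF y])
    have "(\<Union>z\<in>Pair y -` S - Pair y -` W. {z}) \<in> null_sets (K y)"
      using S_countable[OF y] y
      by (intro null_sets_UN') (auto simp: W_def a_def null_sets_def sets_K[OF y] space_pair_measure)
    then have "Pair y -` S - Pair y -` W \<in> null_sets (K y)" by simp
    then have "emeasure (K y) (Pair y -` S) \<le> emeasure (K y) (Pair y -` W \<union> (Pair y -` S - Pair y -` W))"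
      using sec[OF S] sec[OF W] by (intro emeasure_mono) auto
    also have "\<dots> = emeasure (K y) (Pair y -` W)"
      by (rule emeasure_Un_null_set) (use sec[OF W] \<open>Pair y -` S - Pair y -` W \<in> null_sets (K y)\<close> in auto)
    finally show "emeasure (K y) (Pair y -` S) \<le> emeasure (K y) (Pair y -` W)" .
  qed
  also have "\<dots> = emeasure M {x\<in>space M. (f x, e x) \<in> W}" using law[OF W] by simp
  finally have "prob {x\<in>space M. (f x, e x) \<in> W} = 1"
    using prob_le_1 by (simp add: emeasure_eq_measure antisym)
  then have AE_W: "AE x in M. a (f x, e x) \<noteq> 0"
    by (subst (asm) prob_Collect_eq_1) (auto simp: W_def)

  define D where "D n = {x\<in>space M. ennreal (1 / Suc n) \<le> a (f x, e x)}" for n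
  show ?thesis
  proof (rule that[of D])
    show D_meas: "D n \<in> sets M" for n unfolding D_def by measurable
    show "incseq D"
    proof (rule incseq_SucI)
      fix n
      have "ennreal (1 / Suc (Suc n)) \<le> ennreal (1 / Suc n)" by (intro ennreal_leI) (simp add: frac_le)
      from order_trans[OF this] show "D n \<subseteq> D (Suc n)" unfolding D_def by blast
    qed
    show "space M - (\<Union>n. D n) \<in> null_sets M"
    proof (rule AE_iff_null_sets[THEN iffD2])
      show "space M - (\<Union>n. D n) \<in> sets M" using D_meas by auto
      show "AE x in M. x \<notin> space M - (\<Union>n. D n)"
        using AE_W
      proof (rule AE_mp, intro AE_I2 impI)
        fix x assume x: "x \<in> space M" "a (f x, e x) \<noteq> 0"
        have "\<exists>n. ennreal (1 / Suc n) \<le> a (f x, e x)"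
        proof (cases "a (f x, e x)")
          case (real r)
          with x have "r > 0" by (auto simp: ennreal_eq_0_iff)
          then obtain n where "1 / Suc n < r" using nat_approx_posE by blast
          then show ?thesis unfolding real(2) by (intro exI[of _ n] ennreal_leI) simp
        qed simp
        then show "x \<notin> space M - (\<Union>n. D n)" by (auto simp: D_def)
      qed
    qed
    show "finite {x\<in>D n. f x = y}" for n y
    proof (cases "y \<in> space N")
      case True
      interpret Ky: prob_space "K y" using prob_K[OF True] .
      have sp: "space (K y) = UNIV" using sets_eq_imp_space_eq[OF sets_K[OF True]] by simp
      have "finite {z\<in>space (K y). ennreal (1 / Suc n) \<le> emeasure (K y) {z}}"
        by (rule Ky.finite_large_atoms) (auto simp: sets_K[OF True])
      then have "finite (e ` {x\<in>D n. f x = y})"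
        by (rule finite_subset[rotated]) (auto simp: D_def a_def sp)
      then show ?thesis
        by (rule finite_imageD) (auto intro!: inj_onI dest: inj_onD[OF e_inj] simp: D_def)
    next
      case False
      then have "{x\<in>D n. f x = y} = {}" using measurable_space[OF f] by (auto simp: D_def)
      then show ?thesis by (simp only: finite.emptyI)
    qed
  qed
qed

section \<open>Unions of hyperfinite pieces\<close>

lemma sets_pair_restrict_space_iff:
  assumes C: "C \<in> sets X"
  shows "R \<in> sets (restrict_space X C \<Otimes>\<^sub>M restrict_space X C) \<longleftrightarrow> R \<in> sets (X \<Otimes>\<^sub>M X) \<and> R \<subseteq> C \<times> C"
    (is "R \<in> sets ?Q \<longleftrightarrow> _")
proof
  have C': "C \<inter> space X = C" using sets.sets_into_space[OF C] by auto
  have space_Q: "space ?Q = C \<times> C" using C' by (simp add: space_pair_measure space_restrict_space)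
  {
    assume R: "R \<in> sets ?Q"
    have "sets ?Q \<subseteq> sets (X \<Otimes>\<^sub>M X)"
      unfolding sets_pair_measure[of "restrict_space X C"]
    proof (rule sets.sigma_sets_subset', safe)
      fix a b assume "a \<in> sets (restrict_space X C)" "b \<in> sets (restrict_space X C)"
      then show "a \<times> b \<in> sets (X \<Otimes>\<^sub>M X)" using C by (simp add: sets_restrict_space_iff)
    qed (use C C' in \<open>auto simp: space_restrict_space\<close>)
    then show "R \<in> sets (X \<Otimes>\<^sub>M X) \<and> R \<subseteq> C \<times> C"
      using R sets.sets_into_space[OF R] space_Q by auto
  }
  assume R: "R \<in> sets (X \<Otimes>\<^sub>M X) \<and> R \<subseteq> C \<times> C"
  have "(\<lambda>w. (fst w, snd w)) \<in> ?Q \<rightarrow>\<^sub>M X \<Otimes>\<^sub>M X"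
    by (intro measurable_Pair measurable_compose[OF measurable_fst] measurable_compose[OF measurable_snd]
        measurable_restrict_space1 measurable_ident_sets[OF refl])
  from measurable_sets[OF this, of R] R show "R \<in> sets ?Q"
    by (simp add: space_Q Int_absorb2)
qed

text \<open>Injectivity embeds each class of a pulled-back relation into a finite class. This serves
  both for inclusions of subsets and for the transport along an injection into the reals.\<close>

lemma hyperfinite_pullback:
  assumes G: "hyperfinite Z G" and e [measurable]: "e \<in> X \<rightarrow>\<^sub>M Z" and inj: "inj_on e (space X)"
  shows "hyperfinite X {(x, y) \<in> space X \<times> space X. (e x, e y) \<in> G}"
proof -
  let ?p = "\<lambda>R. {(x, y) \<in> space X \<times> space X. (e x, e y) \<in> R}"
  from G obtain En :: "nat \<Rightarrow> _" where En: "incseq En" "\<And>n. finite_borel_equiv Z (En n)" "\<And>n. En n \<subseteq> G" "G = (\<Union>n. En n)"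
    by (auto simp: hyperfinite_def borel_subequiv_def)
  have eX: "e x \<in> space Z" if "x \<in> space X" for x using measurable_space[OF e that] .
  have "finite_borel_equiv X (?p (En n))" for n
  proof -
    have eq: "equiv (space Z) (En n)" and [measurable]: "En n \<in> sets (Z \<Otimes>\<^sub>M Z)"
      and fin: "\<And>x. x \<in> space Z \<Longrightarrow> finite (En n `` {x})"
      using En(2)[of n] by (auto simp: finite_borel_equiv_def borel_equiv_def)
    have "equiv (space X) (?p (En n))"
    proof (rule equivI)
      show "refl_on (space X) (?p (En n))"
        using eq eX by (auto simp: refl_on_def equiv_def)
      show "sym (?p (En n))" using eq by (auto simp: sym_def equiv_def)
      show "trans (?p (En n))" using eq unfolding trans_def equiv_def by blast
    qed auto
    moreover have "?p (En n) = {w \<in> space (X \<Otimes>\<^sub>M X). (e (fst w), e (snd w)) \<in> En n}"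
      by (auto simp: space_pair_measure)
    moreover have "{w \<in> space (X \<Otimes>\<^sub>M X). (e (fst w), e (snd w)) \<in> En n} \<in> sets (X \<Otimes>\<^sub>M X)" by measurable
    moreover have "finite (?p (En n) `` {x})" if "x \<in> space X" for x
    proof (rule finite_imageD[of e])
      show "finite (e ` (?p (En n) `` {x}))"
        by (rule finite_subset[OF _ fin[OF eX[OF that]]]) auto
      show "inj_on e (?p (En n) `` {x})" by (rule inj_on_subset[OF inj]) auto
    qed
    ultimately show ?thesis by (simp add: finite_borel_equiv_def borel_equiv_def)
  qed
  moreover have "incseq (\<lambda>n. ?p (En n))" using En(1) by (auto simp: incseq_def subset_eq)
  moreover have "?p G = (\<Union>n. ?p (En n))" using En(4) by auto
  ultimately show ?thesis
    unfolding hyperfinite_def borel_subequiv_def using En(3)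
    by (intro exI[of _ "\<lambda>n. ?p (En n)"]) (auto simp: finite_borel_equiv_def)
qed

lemma hyperfinite_restrict_subset:
  assumes "hyperfinite (restrict_space X B) (Restr E B)" "B \<in> sets X" "B' \<in> sets X" "B' \<subseteq> B"
  shows "hyperfinite (restrict_space X B') (Restr E B')"
proof -
  have B: "B \<inter> space X = B" "B' \<inter> space X = B'" using assms(2,3) sets.sets_into_space by blast+
  have "(\<lambda>x. x) \<in> restrict_space X B' \<rightarrow>\<^sub>M restrict_space X B"
    by (rule measurable_restrict_space3) (use assms(4) in auto)
  from hyperfinite_pullback[OF assms(1) this]
  have "hyperfinite (restrict_space X B') {(x, y) \<in> B' \<times> B'. (x, y) \<in> Restr E B}"
    by (simp add: space_restrict_space B)
  also have "{(x, y) \<in> B' \<times> B'. (x, y) \<in> Restr E B} = Restr E B'" using assms(4) by auto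
  finally show ?thesis .
qed

lemma standard_borel_cong: "sets M = sets X \<Longrightarrow> standard_borel M \<longleftrightarrow> standard_borel X"
  using sets_eq_imp_space_eq[of M X] by (simp add: standard_borel_def)

text \<open>
  Every point of a conull set is sent by \<open>g\<close> into the first piece met by its class, the
  selections being countable-to-one because classes are countable. The finite relations of that piece
  are pulled back along \<open>g\<close>, restricted at stage \<open>n\<close> to a set \<open>D n\<close> where \<open>g\<close> is finite-to-one.
\<close>

theorem mu_hyperfinite_if_countable_union:
  fixes X :: "'a measure" and A :: "nat \<Rightarrow> 'a set"
  assumes X: "standard_borel X" and E: "countable_borel_equiv X E" and \<mu>: "borel_prob_on X \<mu>"
    and A: "\<And>j. A j \<in> sets X" and hyp: "\<And>j. hyperfinite (restrict_space X (A j)) (Restr E (A j))"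
    and conull: "space X - (\<Union>j. A j) \<in> null_sets \<mu>"
  shows "mu_hyperfinite \<mu> X E"
proof -
  interpret prob_space \<mu> using \<mu> by (simp add: borel_prob_on_def)
  have sets_\<mu> [measurable_cong]: "sets \<mu> = sets X" using \<mu> by (simp add: borel_prob_on_def)
  have space_\<mu>: "space \<mu> = space X" by (rule sets_eq_imp_space_eq[OF sets_\<mu>])
  note A [measurable]
  have A_X: "A j \<subseteq> space X" for j using sets.sets_into_space[OF A] .
  have eq: "equiv (space X) E" and E_meas [measurable]: "E \<in> sets (X \<Otimes>\<^sub>M X)"
    and E_cnt: "\<And>x. x \<in> space X \<Longrightarrow> countable (E `` {x})"
    using E by (auto simp: countable_borel_equiv_def borel_equiv_def)
  have E_refl: "(x, x) \<in> E" if "x \<in> space X" for x using eq that by (auto simp: equiv_def refl_on_def)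
  have E_sym: "(y, x) \<in> E" if "(x, y) \<in> E" for x y using eq that by (auto simp: equiv_def sym_def)
  have E_trans: "(x, z) \<in> E" if "(x, y) \<in> E" "(y, z) \<in> E" for x y z
    using eq that by (auto simp: equiv_def trans_def)
  have E_X: "x \<in> space X \<and> y \<in> space X" if "(x, y) \<in> E" for x y
    using sets.sets_into_space[OF E_meas] that by (auto simp: space_pair_measure)

  have "\<exists>S N f. S \<in> sets X \<and> N \<in> null_sets \<mu> \<and> f \<in> X \<rightarrow>\<^sub>M X \<and>
    (\<forall>x\<in>S. (x, f x) \<in> E \<and> f x \<in> A j) \<and> (\<forall>x y. (x, y) \<in> E \<and> y \<in> A j \<longrightarrow> x \<in> S \<union> N)" for j
  proof -
    have "{w \<in> space (X \<Otimes>\<^sub>M X). w \<in> E \<and> snd w \<in> A j} \<in> sets (X \<Otimes>\<^sub>M X)" by measurable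
    moreover have "{w \<in> space (X \<Otimes>\<^sub>M X). w \<in> E \<and> snd w \<in> A j} = {(x, y) \<in> E. y \<in> A j}"
      using E_X by (auto simp: space_pair_measure)
    ultimately have P: "{(x, y) \<in> E. y \<in> A j} \<in> sets (\<mu> \<Otimes>\<^sub>M X)"
      by (simp cong: sets_pair_measure_cong add: sets_\<mu>)
    have id: "(\<lambda>x. x) \<in> \<mu> \<rightarrow>\<^sub>M X" by simp
    show ?thesis
    proof (rule measurable_selection[OF finite_measure_axioms X P id])
      fix S N f assume "S \<in> sets \<mu>" "N \<in> null_sets \<mu>" "f \<in> \<mu> \<rightarrow>\<^sub>M X"
        "\<And>x. x \<in> S \<Longrightarrow> (x, f x) \<in> {(x, y) \<in> E. y \<in> A j}"
        "\<And>x y. (x, y) \<in> {(x, y) \<in> E. y \<in> A j} \<Longrightarrow> x \<in> S \<union> N"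
      then show ?thesis by (intro exI[of _ S] exI[of _ N] exI[of _ f]) (auto simp: sets_\<mu>)
    qed
  qed
  then obtain S N f where S [measurable]: "\<And>j. S j \<in> sets X" and N: "\<And>j. N j \<in> null_sets \<mu>"
    and f [measurable]: "\<And>j. f j \<in> X \<rightarrow>\<^sub>M X"
    and f_E: "\<And>j x. x \<in> S j \<Longrightarrow> (x, f j x) \<in> E" and f_A: "\<And>j x. x \<in> S j \<Longrightarrow> f j x \<in> A j"
    and SN: "\<And>j x y. (x, y) \<in> E \<Longrightarrow> y \<in> A j \<Longrightarrow> x \<in> S j \<union> N j"
    by metis
  \<comment> \<open>Removing the sets \<open>N j\<close> makes the \<open>S j\<close> invariant on
    \<open>C0\<close>: if x lies in \<open>S j\<close> and y is equivalent to x, then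
    \<open>f j x\<close> witnesses that the class of y meets \<open>A j\<close>, so y lies in
    \<open>S j\<close> or in the removed \<open>N j\<close>.\<close>
  define C0 where "C0 = (\<Union>j. A j) - (\<Union>j. N j)"
  have N_meas [measurable]: "N j \<in> sets X" for j using N[of j] sets_\<mu> by auto
  have C0 [measurable]: "C0 \<in> sets X" unfolding C0_def by measurable
  have C0_X: "x \<in> space X" if "x \<in> C0" for x using sets.sets_into_space[OF C0] that by auto
  have C0_S: "\<exists>j. x \<in> S j" if "x \<in> C0" for x
    using that SN[OF E_refl[OF C0_X[OF that]]] by (auto simp: C0_def)
  have S_inv: "y \<in> S j" if "x \<in> S j" "(x, y) \<in> E" "y \<in> C0" for x y j
    using SN[OF E_trans[OF E_sym[OF that(2)] f_E[OF that(1)]] f_A[OF that(1)]] that(3) by (auto simp: C0_def)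
  \<comment> \<open>By this invariance the least index is constant on each class within
    \<open>C0\<close>, so equivalent points are sent into the same piece.\<close>
  define j where "j x = (LEAST j. x \<in> S j)" for x
  have j_meas [measurable]: "j \<in> X \<rightarrow>\<^sub>M count_space UNIV" unfolding j_def by measurable
  have j_S: "x \<in> S (j x)" if "x \<in> C0" for x unfolding j_def using C0_S[OF that] by (rule LeastI_ex)
  have j_eq: "j x = j y" if "(x, y) \<in> E" "x \<in> C0" "y \<in> C0" for x y
  proof -
    have "x \<in> S i \<longleftrightarrow> y \<in> S i" for i using S_inv E_sym that by blast
    then show ?thesis by (simp add: j_def)
  qed
  \<comment> \<open>The identity off \<open>C0\<close> keeps x and g x equivalent on all of
    \<open>X\<close>; each fibre of g then lies in one class and is countable.\<close>
  define g where "g x = (if x \<in> C0 then f (j x) x else x)" for x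
  have g [measurable]: "g \<in> X \<rightarrow>\<^sub>M X"
  proof -
    have "(\<lambda>x. f (j x) x) \<in> X \<rightarrow>\<^sub>M X" by (rule measurable_compose_countable[OF f j_meas])
    then show ?thesis unfolding g_def by (intro measurable_If) auto
  qed
  have g_E: "(x, g x) \<in> E" if "x \<in> space X" for x
    using that f_E[OF j_S] E_refl by (auto simp: g_def)
  have g_A: "g x \<in> A (j x)" if "x \<in> C0" for x using that f_A[OF j_S] by (auto simp: g_def)
  have g_cnt: "countable {x\<in>space \<mu>. g x = y}" if "y \<in> space X" for y
    by (rule countable_subset[OF _ E_cnt[OF that]]) (auto simp: space_\<mu> intro: E_sym dest: g_E)
  have g': "g \<in> \<mu> \<rightarrow>\<^sub>M X" by simp
  have "standard_borel \<mu>" using X standard_borel_cong[OF sets_\<mu>] by simp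
  obtain D :: "nat \<Rightarrow> 'a set" where D': "\<And>n. D n \<in> sets \<mu>" and D_inc: "incseq D"
    and D_null: "space \<mu> - (\<Union>n. D n) \<in> null_sets \<mu>" and D_fin: "\<And>n y. finite {x\<in>D n. g x = y}"
  proof (rule countable_to_one_finite_to_one_pieces[OF prob_space_axioms \<open>standard_borel \<mu>\<close> X g'])
    show "countable {x\<in>space \<mu>. g x = y}" if "y \<in> space X" for y using that by (rule g_cnt)
  qed (rule that)
  have D [measurable]: "D n \<in> sets X" for n using D' sets_\<mu> by simp
  define C where "C = C0 \<inter> (\<Union>n. D n)"
  have C [measurable]: "C \<in> sets X" unfolding C_def by measurable
  have C_sub: "x \<in> space X" if "x \<in> C" for x using sets.sets_into_space[OF C] that by auto
  then have C_X: "C \<inter> space X = C" by auto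
  have C_conull: "conull \<mu> C"
  proof -
    have "(space X - (\<Union>j. A j)) \<union> (\<Union>j. N j) \<union> (space \<mu> - (\<Union>n. D n)) \<in> null_sets \<mu>"
      using conull N D_null by (intro null_sets.Un null_sets_UN) auto
    then have "space \<mu> - C \<in> null_sets \<mu>"
      by (rule null_sets_subset) (auto simp: C_def C0_def space_\<mu> sets_\<mu>)
    then show ?thesis using C sets_\<mu> by (simp add: conull_def)
  qed

  from hyp have "\<exists>G :: nat \<Rightarrow> 'a rel. incseq G \<and>
       (\<forall>n. finite_borel_equiv (restrict_space X (A i)) (G n) \<and> borel_subequiv (restrict_space X (A i)) (G n) (Restr E (A i))) \<and>
       Restr E (A i) = (\<Union>n. G n)" for i
    unfolding hyperfinite_def by blast
  then obtain G :: "nat \<Rightarrow> nat \<Rightarrow> 'a rel" where G_inc: "\<And>i. incseq (G i)"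
    and G_fbe: "\<And>i n. finite_borel_equiv (restrict_space X (A i)) (G i n)"
    and G_UN: "\<And>i. Restr E (A i) = (\<Union>n. G i n)"
    by metis
  have space_A: "space (restrict_space X (A i)) = A i" for i
    using A_X[of i] by (auto simp: space_restrict_space)
  have G_eq: "equiv (A i) (G i n)" and G_meas [measurable]: "G i n \<in> sets (X \<Otimes>\<^sub>M X)"
    and G_fin: "\<And>x. x \<in> A i \<Longrightarrow> finite (G i n `` {x})" for i n
    using G_fbe[of i n] sets_pair_restrict_space_iff[OF A[of i]]
    by (auto simp: finite_borel_equiv_def borel_equiv_def space_A)
  have G_refl: "(x, x) \<in> G i n" if "x \<in> A i" for i n x
    using G_eq[of i n] that by (auto simp: equiv_def refl_on_def)
  have G_sym: "(y, x) \<in> G i n" if "(x, y) \<in> G i n" for i n x y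
    using G_eq[of i n] that by (auto simp: equiv_def sym_def)
  have G_trans: "(x, z) \<in> G i n" if "(x, y) \<in> G i n" "(y, z) \<in> G i n" for i n x y z
    using G_eq[of i n] that by (auto simp: equiv_def trans_def)
  have G_E: "(x, y) \<in> E" if "(x, y) \<in> G i n" for i n x y using G_UN[of i] that by blast

  \<comment> \<open>The diagonal supplies reflexivity at points of \<open>C\<close> outside
    \<open>D n\<close>. The common index means that a single relation \<open>G (j x) n\<close> is
    consulted, and g has finite fibres in \<open>D n\<close>, so classes stay finite.\<close>
  define R where "R n = {(x, y) \<in> C \<times> C. x = y \<or>
    x \<in> D n \<and> y \<in> D n \<and> j x = j y \<and> (g x, g y) \<in> G (j x) n}" for n
  have R_E: "R n \<subseteq> Restr E C" for n
  proof
    fix w assume "w \<in> R n"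
    then obtain x y where w: "w = (x, y)" "x \<in> C" "y \<in> C" and xy: "x = y \<or> (g x, g y) \<in> G (j x) n"
      by (auto simp: R_def)
    have X: "x \<in> space X" "y \<in> space X" using w C_sub by auto
    have "(x, y) \<in> E"
      using xy
    proof
      assume "(g x, g y) \<in> G (j x) n"
      then show ?thesis using G_E E_trans[OF g_E[OF X(1)] E_trans[OF _ E_sym[OF g_E[OF X(2)]]]] by blast
    qed (use E_refl X in auto)
    then show "w \<in> Restr E C" using w by auto
  qed
  have R_equiv: "equiv C (R n)" for n
  proof (rule equivI)
    show "R n \<subseteq> C \<times> C" by (auto simp: R_def)
    show "refl_on C (R n)" by (auto simp: R_def refl_on_def)
    show "sym (R n)" by (rule symI) (auto simp: R_def intro: G_sym)
    show "trans (R n)" by (rule transI) (auto simp: R_def intro: G_trans)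
  qed
  \<comment> \<open>The real coding makes the diagonal part of \<open>R n\<close> measurable, as an
    equation between real functions.\<close>
  obtain e :: "'a \<Rightarrow> real" where e [measurable]: "e \<in> borel_measurable X" and e_inj: "inj_on e (space X)"
    using standard_borel_real_injection[OF X] by blast
  have R_meas: "R n \<in> sets (restrict_space X C \<Otimes>\<^sub>M restrict_space X C)" for n
  proof -
    have "{w \<in> space (X \<Otimes>\<^sub>M X). fst w \<in> C \<and> snd w \<in> C \<and> (e (fst w) = e (snd w) \<or>
        fst w \<in> D n \<and> snd w \<in> D n \<and> (\<exists>i. j (fst w) = i \<and> j (snd w) = i \<and> (g (fst w), g (snd w)) \<in> G i n))}
      \<in> sets (X \<Otimes>\<^sub>M X)" (is "?R \<in> _")
      by measurable
    moreover have "?R = R n"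
      using C_sub inj_onD[OF e_inj] by (auto simp: R_def space_pair_measure)
    ultimately show ?thesis by (auto simp: sets_pair_restrict_space_iff[OF C] R_def)
  qed
  have R_fin: "finite (R n `` {x})" if "x \<in> C" for n x
  proof (rule finite_subset)
    show "R n `` {x} \<subseteq> {x} \<union> (\<Union>z\<in>G (j x) n `` {g x}. {y\<in>D n. g y = z})" by (auto simp: R_def)
    show "finite ({x} \<union> (\<Union>z\<in>G (j x) n `` {g x}. {y\<in>D n. g y = z}))"
      using that g_A[of x] by (intro finite_UnI finite_UN_I D_fin G_fin) (auto simp: C_def)
  qed
  have R_inc: "incseq R"
  proof (rule incseq_SucI)
    fix n show "R n \<subseteq> R (Suc n)"
      using incseq_SucD[OF D_inc, of n] incseq_SucD[OF G_inc, of _ n] unfolding R_def by blast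
  qed
  have R_UN: "Restr E C = (\<Union>n. R n)"
  proof
    show "Restr E C \<subseteq> (\<Union>n. R n)"
    proof
      fix w assume "w \<in> Restr E C"
      then obtain x y where w: "w = (x, y)" "x \<in> C" "y \<in> C" "(x, y) \<in> E" by auto
      then have C0: "x \<in> C0" "y \<in> C0" and X: "x \<in> space X" "y \<in> space X" using C_sub by (auto simp: C_def)
      have jj: "j x = j y" using j_eq w(4) C0 by blast
      have "(g x, g y) \<in> E"
        using E_trans[OF E_sym[OF g_E[OF X(1)]] E_trans[OF w(4) g_E[OF X(2)]]] .
      then have "(g x, g y) \<in> Restr E (A (j x))" using g_A[OF C0(1)] g_A[OF C0(2)] jj by auto
      then obtain n1 where n1: "(g x, g y) \<in> G (j x) n1" using G_UN by auto
      obtain n2 n3 where n2: "x \<in> D n2" and n3: "y \<in> D n3" using w by (auto simp: C_def)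
      define n where "n = max n1 (max n2 n3)"
      have "n1 \<le> n" "n2 \<le> n" "n3 \<le> n" by (auto simp: n_def)
      then have "(g x, g y) \<in> G (j x) n" "x \<in> D n" "y \<in> D n"
        using n1 n2 n3 monoD[OF G_inc, of n1 n] monoD[OF D_inc, of n2 n] monoD[OF D_inc, of n3 n]
        by auto
      then have "w \<in> R n" using w jj by (auto simp: R_def)
      then show "w \<in> (\<Union>n. R n)" by blast
    qed
    show "(\<Union>n. R n) \<subseteq> Restr E C" using R_E by blast
  qed
  have "hyperfinite (restrict_space X C) (Restr E C)"
    unfolding hyperfinite_def
    using R_inc R_equiv R_meas R_fin R_E R_UN C_X
    by (intro exI[of _ R])
      (auto simp: finite_borel_equiv_def borel_subequiv_def borel_equiv_def space_restrict_space)
  then show ?thesis using C C_conull by (auto simp: mu_hyperfinite_def)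
qed

section \<open>Exhaustion by hyperfinite sets\<close>

lemma exists_nowhere_hyperfinite_measure:
  fixes X :: "'a measure"
  assumes X: "standard_borel X" and E: "countable_borel_equiv X E" and not: "\<not> measure_hyperfinite X E"
  shows "\<exists>m. borel_prob_on X m \<and> mu_nowhere_hyperfinite m X E"
proof -
  obtain \<mu> where \<mu>: "borel_prob_on X \<mu>" and not_\<mu>: "\<not> mu_hyperfinite \<mu> X E"
    using not by (auto simp: measure_hyperfinite_def)
  interpret prob_space \<mu> using \<mu> by (simp add: borel_prob_on_def)
  have sets_\<mu>: "sets \<mu> = sets X" using \<mu> by (simp add: borel_prob_on_def)
  have space_\<mu>: "space \<mu> = space X" by (rule sets_eq_imp_space_eq[OF sets_\<mu>])
  define \<H> where "\<H> = {A \<in> sets X. hyperfinite (restrict_space X A) (Restr E A)}"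
  \<comment> \<open>Members of \<U> are mere unions, with no claim that the relation is hyperfinite
    on them. Closure under countable unions is what lets the supremum of their measures be attained,
    by \<open>V\<close>.\<close>
  define \<U> where "\<U> = {\<Union>(range A) | A :: nat \<Rightarrow> 'a set. range A \<subseteq> \<H>}"
  have \<U>_sets: "U \<in> sets X" if U: "U \<in> \<U>" for U
  proof -
    obtain A :: "nat \<Rightarrow> 'a set" where A: "U = \<Union>(range A)" "range A \<subseteq> \<H>"
      using U unfolding \<U>_def by blast
    have "range A \<subseteq> sets X" using A(2) unfolding \<H>_def by blast
    then show ?thesis unfolding A(1) by (rule sets.countable_UN)
  qed
  have \<U>_UN: "(\<Union>n. U n) \<in> \<U>" if U: "\<And>n::nat. U n \<in> \<U>" for U
  proof -
    have "\<exists>A :: nat \<Rightarrow> 'a set. U n = \<Union>(range A) \<and> range A \<subseteq> \<H>" for n using U[of n] unfolding \<U>_def by blast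
    then obtain A :: "nat \<Rightarrow> nat \<Rightarrow> 'a set" where A: "\<And>n. U n = \<Union>(range (A n))" "\<And>n. range (A n) \<subseteq> \<H>" by metis
    define A' where "A' k = A (fst (prod_decode k)) (snd (prod_decode k))" for k
    have "(\<Union>n. U n) = \<Union>(range A')" unfolding A(1)
    proof (intro set_eqI iffI)
      fix x assume "x \<in> (\<Union>n. \<Union>(range (A n)))"
      then obtain n i where "x \<in> A n i" by blast
      then have "x \<in> A' (prod_encode (n, i))" by (simp add: A'_def)
      then show "x \<in> \<Union>(range A')" by blast
    qed (auto simp: A'_def)
    moreover have "range A' \<subseteq> \<H>" using A(2) by (auto simp: A'_def)
    ultimately show ?thesis unfolding \<U>_def by blast
  qed
  have \<H>_\<U>: "A \<in> \<U>" if "A \<in> \<H>" for A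
    unfolding \<U>_def using that by (intro CollectI exI[of _ "\<lambda>_. A"]) auto
  have "{} \<in> \<H>"
    unfolding \<H>_def hyperfinite_def finite_borel_equiv_def borel_subequiv_def borel_equiv_def
    by (auto simp: space_restrict_space incseq_def equiv_def refl_on_def sym_def trans_def intro!: exI[of _ "\<lambda>_. {}"])
  then have "\<U> \<noteq> {}" using \<H>_\<U> by blast
  then obtain u :: "nat \<Rightarrow> ennreal" where u: "range u \<subseteq> emeasure \<mu> ` \<U>" "Sup (emeasure \<mu> ` \<U>) = Sup (range u)"
    using ennreal_Sup_countable_SUP[of "emeasure \<mu> ` \<U>"] by auto
  then have "\<forall>n. \<exists>U\<in>\<U>. u n = emeasure \<mu> U" by blast
  then obtain U where U: "\<And>n. U n \<in> \<U>" "\<And>n. u n = emeasure \<mu> (U n)" by metis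
  define V where "V = (\<Union>n. U n)"
  have V: "V \<in> \<U>" unfolding V_def by (rule \<U>_UN[OF U(1)])
  have V_sets: "V \<in> sets X" by (rule \<U>_sets[OF V])
  have V_max: "emeasure \<mu> W \<le> emeasure \<mu> V" if "W \<in> \<U>" for W
  proof -
    have "emeasure \<mu> W \<le> Sup (range u)" unfolding u(2)[symmetric] using that by (intro Sup_upper) auto
    also have "\<dots> \<le> emeasure \<mu> V"
      unfolding U(2) using V_sets by (intro SUP_least emeasure_mono) (auto simp: V_def sets_\<mu>)
    finally show ?thesis .
  qed
  define B where "B = space X - V"
  have B [measurable]: "B \<in> sets X" using V_sets by (auto simp: B_def)
  \<comment> \<open>Adjoining \<open>B'\<close> to \<open>V\<close> stays in \<U> and cannot
    increase the maximal measure; since the two sets are disjoint and the measure is finite,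
    \<open>B'\<close> is null.\<close>
  have B_null: "emeasure \<mu> B' = 0" if B': "B' \<in> \<H>" "B' \<subseteq> B" for B'
  proof -
    have "V \<union> B' = (\<Union>n::nat. if n = 0 then V else B')"
      unfolding set_eq_iff UN_iff Un_iff by (metis UNIV_I zero_neq_one)
    then have "V \<union> B' \<in> \<U>" using \<U>_UN[of "\<lambda>n. if n = 0 then V else B'"] V \<H>_\<U>[OF B'(1)] by simp
    then have "emeasure \<mu> (V \<union> B') \<le> emeasure \<mu> V" by (rule V_max)
    moreover have "emeasure \<mu> (V \<union> B') = emeasure \<mu> V + emeasure \<mu> B'"
      using B' V_sets by (intro plus_emeasure[symmetric]) (auto simp: B_def \<H>_def sets_\<mu>)
    ultimately have "emeasure \<mu> V + emeasure \<mu> B' \<le> emeasure \<mu> V + 0" by simp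
    then show ?thesis by (simp add: ennreal_add_left_cancel_le top_unique)
  qed
  have B_pos: "emeasure \<mu> B \<noteq> 0"
  proof
    assume "emeasure \<mu> B = 0"
    obtain A :: "nat \<Rightarrow> 'a set" where A: "V = \<Union>(range A)" "range A \<subseteq> \<H>" using V unfolding \<U>_def by blast
    have "space X - (\<Union>j. A j) \<in> null_sets \<mu>"
      using \<open>emeasure \<mu> B = 0\<close> B by (auto simp: A(1)[symmetric] B_def null_sets_def sets_\<mu>)
    moreover have "A j \<in> sets X" "hyperfinite (restrict_space X (A j)) (Restr E (A j))" for j
      using A(2) by (auto simp: \<H>_def)
    ultimately have "mu_hyperfinite \<mu> X E"
      by (intro mu_hyperfinite_if_countable_union[OF X E \<mu>, of A])
    with not_\<mu> show False ..
  qed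
  show ?thesis
  \<comment> \<open>The witness is \<mu> conditioned on the complement \<open>B\<close> of the
    maximal union. Hyperfiniteness passes from \<open>B'\<close> to \<open>B \<inter> B'\<close>,
    which is null by maximality.\<close>
  proof (intro exI conjI)
    show "borel_prob_on X (uniform_measure \<mu> B)"
      using B_pos B sets_\<mu> by (auto simp: borel_prob_on_def intro!: prob_space_uniform_measure)
    show "mu_nowhere_hyperfinite (uniform_measure \<mu> B) X E"
      unfolding mu_nowhere_hyperfinite_def
    proof
      assume "\<exists>B'\<in>sets X. 0 < emeasure (uniform_measure \<mu> B) B' \<and> hyperfinite (restrict_space X B') (Restr E B')"
      then obtain B' where B': "B' \<in> sets X" "0 < emeasure (uniform_measure \<mu> B) B'"
        "hyperfinite (restrict_space X B') (Restr E B')" by blast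
      have "B \<inter> B' \<in> \<H>"
        using hyperfinite_restrict_subset[OF B'(3) B'(1), of "B \<inter> B'"] B B' by (auto simp: \<H>_def)
      then have "emeasure \<mu> (B \<inter> B') = 0" by (rule B_null) auto
      then have "emeasure (uniform_measure \<mu> B) B' = 0"
        using B B' sets_\<mu> by (simp add: emeasure_uniform_measure)
      with B'(2) show False by simp
    qed
  qed
qed

section \<open>Transport to the reals and the main argument\<close>

text \<open>
  Only an injection of \<open>X\<close> into the reals is needed: the topology is transported along it, so the image
  need not carry the Borel structure of the reals.
\<close>

lemma standard_borel_embed_measure:
  assumes X: "standard_borel X" and e: "inj_on e (space X)"
  shows "standard_borel (embed_measure X e)"
proof -
  obtain T where T: "completely_metrizable_space T" "separable_space T"
    "topspace T = space X" "sets X = sigma_sets (topspace T) {U. openin T U}"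
    using X by (auto simp: standard_borel_def)
  define i where "i = the_inv_into (space X) e"
  have i_e: "i (e x) = x" if "x \<in> space X" for x
    using the_inv_into_f_f[OF e that] by (simp add: i_def)
  \<comment> \<open>This topology makes e a homeomorphism onto its image, with inverse i.\<close>
  define T' where "T' = pullback_topology (e ` space X) i T"
  have top: "topspace T' = e ` space X"
    using T(3) i_e by (auto simp: T'_def topspace_pullback_topology)
  have "continuous_map T T' e"
    unfolding continuous_map_alt
  proof safe
    fix x assume "x \<in> topspace T" then show "e x \<in> topspace T'" using T(3) top by auto
  next
    fix S assume "openin T' S"
    then obtain U where U: "openin T U" "S = i -` U \<inter> e ` space X"
      by (auto simp: T'_def openin_pullback_topology)
    have "e -` S \<inter> topspace T = U"
      using openin_subset[OF U(1)] i_e T(3) by (fastforce simp: U(2))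
    then show "openin T (e -` S \<inter> topspace T)" using U(1) by simp
  qed
  moreover have "continuous_map T' T i"
    unfolding continuous_map_alt
  proof safe
    fix z assume "z \<in> topspace T'" then show "i z \<in> topspace T" using T(3) top i_e by auto
  next
    fix U assume "openin T U"
    then show "openin T' (i -` U \<inter> topspace T')"
      unfolding top by (auto simp: T'_def openin_pullback_topology)
  qed
  ultimately have "homeomorphic_maps T T' e i"
    using i_e T(3) top by (auto simp: homeomorphic_maps_def)
  then have "T homeomorphic_space T'" by (auto simp: homeomorphic_space_def)
  then have "completely_metrizable_space T'" "separable_space T'"
    using T homeomorphic_completely_metrizable_space homeomorphic_separable_space by blast+
  moreover have "sets (embed_measure X e) = sigma_sets (topspace T') {U. openin T' U}"
  proof -
    have "i \<in> e ` space X \<rightarrow> space X" using i_e by auto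
    have "sets (embed_measure X e) = {i -` A \<inter> e ` space X | A. A \<in> sigma_sets (space X) {U. openin T U}}"
      unfolding sets_embed_eq_vimage_algebra[OF e] i_def[symmetric] sets_vimage_algebra2[OF \<open>i \<in> _\<close>]
      using T by simp
    also have "\<dots> = sigma_sets (e ` space X) {i -` A \<inter> e ` space X | A. A \<in> {U. openin T U}}"
      by (rule sigma_sets_vimage_commute) fact
    also have "{i -` A \<inter> e ` space X | A. A \<in> {U. openin T U}} = {U. openin T' U}"
      by (auto simp: T'_def openin_pullback_topology)
    finally show ?thesis by (simp add: top)
  qed
  ultimately show ?thesis
    unfolding standard_borel_def using top by (auto simp: space_embed_measure)
qed

text \<open>Projective separability is stated for auxiliary spaces of real numbers. Here the space,
  the relation and the measure are copied onto the image of an injection e into the reals, and the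
  resulting set \<open>R'\<close> is pulled back along e in its first coordinate.\<close>

lemma projectively_separableD:
  fixes X :: "'a measure" and Y :: "'b measure"
  assumes F: "projectively_separable Y F" and X: "standard_borel X" and E: "countable_borel_equiv X E"
    and m: "borel_prob_on X m" and nowhere: "mu_nowhere_hyperfinite m X E"
  obtains R where "R \<in> sets (X \<Otimes>\<^sub>M Y)" "\<And>x. x \<in> space X \<Longrightarrow> countable (R `` {x})"
    "\<And>B \<phi>. B \<in> sets X \<Longrightarrow> countable_to_one_hom (restrict_space X B) (Restr E B) Y F \<phi> \<Longrightarrow>
      {x\<in>B. (x, \<phi> x) \<notin> R} \<in> null_sets m"
proof -
  obtain e :: "'a \<Rightarrow> real" where e_inj: "inj_on e (space X)"
    using standard_borel_real_injection[OF X] by blast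
  have sets_m: "sets m = sets X" and prob_m: "prob_space m" using m by (auto simp: borel_prob_on_def)
  have space_m: "space m = space X" by (rule sets_eq_imp_space_eq[OF sets_m])
  define Z where "Z = embed_measure X e"
  define \<nu> where "\<nu> = embed_measure m e"
  define i where "i = the_inv_into (space X) e"
  have i_e: "i (e x) = x" if "x \<in> space X" for x
    using the_inv_into_f_f[OF e_inj that] by (simp add: i_def)
  have space_Z: "space Z = e ` space X" by (simp add: Z_def space_embed_measure)
  have sets_Z: "sets Z = {e ` A | A. A \<in> sets X}" unfolding Z_def by (rule sets_embed_measure'[OF e_inj])
  have sets_\<nu>: "sets \<nu> = sets Z"
    unfolding \<nu>_def sets_Z using e_inj sets_m space_m by (subst sets_embed_measure') auto
  have e [measurable]: "e \<in> X \<rightarrow>\<^sub>M Z" unfolding Z_def by (rule measurable_embed_measure2'[OF e_inj])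
  have i [measurable]: "i \<in> Z \<rightarrow>\<^sub>M X"
    unfolding Z_def
    by (rule measurable_embed_measure1, subst measurable_cong[where g = "\<lambda>x. x"]) (auto simp: i_e)
  have \<nu>: "emeasure \<nu> A = emeasure m (e -` A \<inter> space X)" if "A \<in> sets Z" for A
    unfolding \<nu>_def using that e_inj space_m sets_\<nu> by (subst emeasure_embed_measure') (auto simp: \<nu>_def)
  have E_eq: "equiv (space X) E" and E_meas [measurable]: "E \<in> sets (X \<Otimes>\<^sub>M X)"
    and E_cnt: "\<And>x. x \<in> space X \<Longrightarrow> countable (E `` {x})"
    using E by (auto simp: countable_borel_equiv_def borel_equiv_def)
  define E' where "E' = {(u, v) \<in> space Z \<times> space Z. (i u, i v) \<in> E}"
  have i_X: "i u \<in> space X" if "u \<in> space Z" for u using measurable_space[OF i that] .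
  have e_Z: "e x \<in> space Z" if "x \<in> space X" for x using measurable_space[OF e that] .
  have e_i: "e (i u) = u" if "u \<in> space Z" for u using that i_e by (auto simp: space_Z)
  have E'_e: "(e x, e y) \<in> E' \<longleftrightarrow> (x, y) \<in> E" if "x \<in> space X" "y \<in> space X" for x y
    using that by (simp add: E'_def e_Z i_e)

  have "standard_borel Z" unfolding Z_def by (rule standard_borel_embed_measure[OF X e_inj])
  moreover have "countable_borel_equiv Z E'"
  proof -
    have "equiv (space Z) E'"
    proof (rule equivI)
      show "E' \<subseteq> space Z \<times> space Z" by (auto simp: E'_def)
      show "refl_on (space Z) E'" using E_eq i_X by (auto simp: E'_def refl_on_def equiv_def)
      show "sym E'" using E_eq by (auto simp: E'_def sym_def equiv_def)
      show "trans E'" using E_eq unfolding E'_def trans_def equiv_def by blast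
    qed
    moreover have "E' = {w \<in> space (Z \<Otimes>\<^sub>M Z). (i (fst w), i (snd w)) \<in> E}"
      by (auto simp: E'_def space_pair_measure)
    moreover have "{w \<in> space (Z \<Otimes>\<^sub>M Z). (i (fst w), i (snd w)) \<in> E} \<in> sets (Z \<Otimes>\<^sub>M Z)" by measurable
    moreover have "countable (E' `` {u})" if "u \<in> space Z" for u
    proof (rule countable_subset)
      show "E' `` {u} \<subseteq> e ` (E `` {i u})"
        by (auto simp: E'_def) (metis ImageI e_i image_eqI singletonI)
      show "countable (e ` (E `` {i u}))" using E_cnt[OF i_X[OF that]] by (rule countable_image)
    qed
    ultimately show ?thesis by (simp add: countable_borel_equiv_def borel_equiv_def)
  qed
  moreover have "borel_prob_on Z \<nu>"
  proof -
    have "prob_space (distr m \<nu> e)"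
      using measurable_embed_measure2'[of e m] e_inj space_m
      by (intro prob_space.prob_space_distr[OF prob_m]) (simp add: \<nu>_def)
    moreover have "distr m \<nu> e = \<nu>"
      unfolding \<nu>_def using e_inj space_m by (intro embed_measure_eq_distr'[symmetric]) simp
    ultimately show ?thesis by (simp add: borel_prob_on_def sets_\<nu>)
  qed
  moreover have "mu_nowhere_hyperfinite \<nu> Z E'"
    unfolding mu_nowhere_hyperfinite_def
  proof
    assume "\<exists>B\<in>sets Z. 0 < emeasure \<nu> B \<and> hyperfinite (restrict_space Z B) (Restr E' B)"
    then obtain B where B: "B \<in> sets Z" "0 < emeasure \<nu> B" "hyperfinite (restrict_space Z B) (Restr E' B)" by blast
    define A where "A = e -` B \<inter> space X"
    have A: "A \<in> sets X" unfolding A_def using B(1) by (rule measurable_sets[OF e])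
    have space_A: "space (restrict_space X A) = A" by (auto simp: A_def space_restrict_space)
    have "e \<in> restrict_space X A \<rightarrow>\<^sub>M restrict_space Z B"
      by (rule measurable_restrict_space3[OF e]) (auto simp: A_def)
    moreover have "inj_on e (space (restrict_space X A))"
      unfolding space_A by (rule inj_on_subset[OF e_inj]) (auto simp: A_def)
    ultimately have "hyperfinite (restrict_space X A) {(x, y) \<in> A \<times> A. (e x, e y) \<in> Restr E' B}"
      using hyperfinite_pullback[OF B(3), of e "restrict_space X A"] by (simp add: space_A)
    also have "{(x, y) \<in> A \<times> A. (e x, e y) \<in> Restr E' B} = Restr E A"
      using E'_e by (auto simp: A_def)
    finally have "hyperfinite (restrict_space X A) (Restr E A)" .
    moreover have "0 < emeasure m A" using B(2) \<nu>[OF B(1)] by (simp add: A_def)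
    ultimately show False using nowhere A unfolding mu_nowhere_hyperfinite_def by blast
  qed
  ultimately have "\<exists>R\<in>sets (Z \<Otimes>\<^sub>M Y). (\<forall>z\<in>space Z. countable (R `` {z})) \<and>
      (\<forall>B\<in>sets Z. \<forall>\<phi>. countable_to_one_hom (restrict_space Z B) (Restr E' B) Y F \<phi> \<longrightarrow>
         {z\<in>B. (z, \<phi> z) \<notin> R} \<in> null_sets \<nu>)"
    by (intro F[unfolded projectively_separable_def, THEN spec, THEN spec, THEN spec, THEN mp] conjI)
  then obtain R' where R' [measurable]: "R' \<in> sets (Z \<Otimes>\<^sub>M Y)"
    and R'_prop: "(\<forall>z\<in>space Z. countable (R' `` {z})) \<and>
      (\<forall>B\<in>sets Z. \<forall>\<phi>. countable_to_one_hom (restrict_space Z B) (Restr E' B) Y F \<phi> \<longrightarrow>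
         {z\<in>B. (z, \<phi> z) \<notin> R'} \<in> null_sets \<nu>)" ..
  note R'_cnt = R'_prop[THEN conjunct1, THEN bspec]
    and R'_null = R'_prop[THEN conjunct2, THEN bspec, THEN spec, THEN mp]
  define R where "R = {w \<in> space (X \<Otimes>\<^sub>M Y). (e (fst w), snd w) \<in> R'}"
  show ?thesis
  proof (rule that[of R])
    show "R \<in> sets (X \<Otimes>\<^sub>M Y)" unfolding R_def by measurable
    show "countable (R `` {x})" if "x \<in> space X" for x
      by (rule countable_subset[OF _ R'_cnt[OF e_Z[OF that]]]) (auto simp: R_def)
    fix B \<phi>
    assume B: "B \<in> sets X" and \<phi>: "countable_to_one_hom (restrict_space X B) (Restr E B) Y F \<phi>"
    have B_X: "x \<in> space X" if "x \<in> B" for x using sets.sets_into_space[OF B] that by auto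
    then have space_B: "space (restrict_space X B) = B" by (auto simp: space_restrict_space)
    have \<phi>_meas: "\<phi> \<in> restrict_space X B \<rightarrow>\<^sub>M Y"
      and \<phi>_hom: "\<And>x y. x \<in> B \<Longrightarrow> y \<in> B \<Longrightarrow> (x, y) \<in> E \<Longrightarrow> (\<phi> x, \<phi> y) \<in> F"
      and \<phi>_cnt: "\<And>y. y \<in> space Y \<Longrightarrow> countable {x\<in>B. \<phi> x = y}"
      using \<phi> by (auto simp: countable_to_one_hom_def space_B)
    have \<phi>_Y: "\<phi> x \<in> space Y" if "x \<in> B" for x using measurable_space[OF \<phi>_meas] that space_B by auto
    \<comment> \<open>The copied structure consists of the images of measurable sets, so the image
      of \<open>B\<close> is measurable by construction.\<close>
    have eB: "e ` B \<in> sets Z" using B sets_Z by blast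
    have space_eB: "space (restrict_space Z (e ` B)) = e ` B"
      using B_X by (auto simp: space_restrict_space space_Z)
    have i_eB: "i \<in> restrict_space Z (e ` B) \<rightarrow>\<^sub>M restrict_space X B"
      by (rule measurable_restrict_space3[OF i]) (use B_X i_e in auto)
    have "countable_to_one_hom (restrict_space Z (e ` B)) (Restr E' (e ` B)) Y F (\<lambda>z. \<phi> (i z))"
      unfolding countable_to_one_hom_def space_eB
    proof (intro conjI ballI impI)
      show "(\<lambda>z. \<phi> (i z)) \<in> restrict_space Z (e ` B) \<rightarrow>\<^sub>M Y"
        by (rule measurable_compose[OF i_eB \<phi>_meas])
      fix u v assume "u \<in> e ` B" "v \<in> e ` B" "(u, v) \<in> Restr E' (e ` B)"
      then obtain x y where "u = e x" "v = e y" "x \<in> B" "y \<in> B" "(e x, e y) \<in> E'" by auto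
      then show "(\<phi> (i u), \<phi> (i v)) \<in> F" using \<phi>_hom B_X by (auto simp: i_e E'_e)
    next
      fix y assume "y \<in> space Y"
      have "{u \<in> e ` B. \<phi> (i u) = y} \<subseteq> e ` {x\<in>B. \<phi> x = y}" using B_X by (auto simp: i_e)
      then show "countable {u \<in> e ` B. \<phi> (i u) = y}"
        using \<phi>_cnt[OF \<open>y \<in> space Y\<close>] by (meson countable_image countable_subset)
    qed
    then have null: "{z \<in> e ` B. (z, \<phi> (i z)) \<notin> R'} \<in> null_sets \<nu>" (is "?N \<in> _") by (rule R'_null[OF eB])
    then have N: "?N \<in> sets Z" "emeasure \<nu> ?N = 0" using sets_\<nu> by auto
    have "e -` ?N \<inter> space X = {x\<in>B. (x, \<phi> x) \<notin> R}"
    proof (rule set_eqI)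
      fix x
      have "e x \<in> e ` B \<longleftrightarrow> x \<in> B" if "x \<in> space X"
        using inj_on_image_mem_iff[OF e_inj that, of B] B_X by blast
      then show "x \<in> e -` ?N \<inter> space X \<longleftrightarrow> x \<in> {x\<in>B. (x, \<phi> x) \<notin> R}"
        using B_X[of x] \<phi>_Y[of x] by (cases "x \<in> space X") (auto simp: R_def i_e space_pair_measure simp del: image_iff)
    qed
    then show "{x\<in>B. (x, \<phi> x) \<notin> R} \<in> null_sets m"
      using measurable_sets[OF e N(1)] \<nu>[OF N(1)] N(2) sets_m by (auto simp: null_sets_def)
  qed
qed

theorem theorem5:
  fixes X :: "'a measure" and E :: "'a rel"
  assumes "standard_borel X"
    and "countable_borel_equiv X E"
    and "\<not> measure_hyperfinite X E"
    and "projectively_separable X E"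
  shows "\<not> (\<exists>F. borel_subequiv X F E \<and>
    measure_reducible (X \<Otimes>\<^sub>M (borel :: real measure)) (product_rel E (Id :: real rel)) X F)"
proof
  assume "\<exists>F. borel_subequiv X F E \<and>
    measure_reducible (X \<Otimes>\<^sub>M (borel :: real measure)) (product_rel E (Id :: real rel)) X F"
  then obtain F where F: "equiv (space X) F" "F \<subseteq> E"
    and red: "measure_reducible (X \<Otimes>\<^sub>M (borel :: real measure)) (product_rel E (Id :: real rel)) X F"
    by (auto simp: borel_subequiv_def borel_equiv_def)
  obtain m where m: "borel_prob_on X m" "mu_nowhere_hyperfinite m X E"
    using exists_nowhere_hyperfinite_measure[OF assms(1-3)] by blast
  obtain R where R [measurable]: "R \<in> sets (X \<Otimes>\<^sub>M X)"
    and R_cnt: "\<And>x. x \<in> space X \<Longrightarrow> countable (R `` {x})"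
    and R_null: "\<And>B \<phi>. B \<in> sets X \<Longrightarrow> countable_to_one_hom (restrict_space X B) (Restr E B) X E \<phi> \<Longrightarrow>
      {x\<in>B. (x, \<phi> x) \<notin> R} \<in> null_sets m"
    by (rule projectively_separableD[OF assms(4,1,2) m]) (rule that)
  have E_eq: "equiv (space X) E" and E_cnt: "\<And>x. x \<in> space X \<Longrightarrow> countable (E `` {x})"
    using assms(2) by (auto simp: countable_borel_equiv_def borel_equiv_def)
  interpret m: prob_space m using m(1) by (simp add: borel_prob_on_def)
  have sets_m [measurable_cong]: "sets m = sets X" using m(1) by (simp add: borel_prob_on_def)
  have space_m: "space m = space X" by (rule sets_eq_imp_space_eq[OF sets_m])
  \<comment> \<open>Uniform measure on the unit interval: a probability measure on the reals for
    which countable sets are null.\<close>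
  define \<Lambda> where "\<Lambda> = uniform_measure lborel {0..1::real}"
  interpret \<Lambda>: prob_space \<Lambda> unfolding \<Lambda>_def by (rule prob_space_uniform_measure) auto
  have sets_\<Lambda> [measurable_cong]: "sets \<Lambda> = sets borel" by (simp add: \<Lambda>_def)
  have \<Lambda>_countable: "AE r in \<Lambda>. r \<notin> A" if "countable A" for A
  proof -
    have "AE r in lborel. r \<notin> A" using countable_imp_null_set_lborel[OF that] by (rule AE_not_in)
    then show ?thesis unfolding \<Lambda>_def by (subst AE_uniform_measure) auto
  qed
  interpret P: pair_prob_space m \<Lambda> ..
  have sets_P: "sets (m \<Otimes>\<^sub>M \<Lambda>) = sets (X \<Otimes>\<^sub>M borel)" by (rule sets_pair_measure_cong[OF sets_m sets_\<Lambda>])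
  have space_P: "space (m \<Otimes>\<^sub>M \<Lambda>) = space X \<times> UNIV"
    by (simp add: space_pair_measure space_m \<Lambda>_def)
  have "borel_prob_on (X \<Otimes>\<^sub>M borel) (m \<Otimes>\<^sub>M \<Lambda>)"
    using sets_P P.prob_space_axioms by (simp add: borel_prob_on_def)
  then obtain C \<phi> where C [measurable]: "C \<in> sets (X \<Otimes>\<^sub>M borel)" and C_conull: "conull (m \<Otimes>\<^sub>M \<Lambda>) C"
    and \<phi> [measurable]: "\<phi> \<in> restrict_space (X \<Otimes>\<^sub>M borel) C \<rightarrow>\<^sub>M X"
    and \<phi>_red: "\<forall>v\<in>space (restrict_space (X \<Otimes>\<^sub>M borel) C). \<forall>w\<in>space (restrict_space (X \<Otimes>\<^sub>M borel) C).
      (v, w) \<in> Restr (product_rel E (Id :: real rel)) C \<longleftrightarrow> (\<phi> v, \<phi> w) \<in> F"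
    using red unfolding measure_reducible_def mu_reducible_def borel_reducible_def by blast
  have C_X: "x \<in> space X" if "(x, r) \<in> C" for x r
    using sets.sets_into_space[OF C] that by (auto simp: space_pair_measure)
  have space_C: "space (restrict_space (X \<Otimes>\<^sub>M borel) C) = C"
    using sets.sets_into_space[OF C] by (auto simp: space_restrict_space)
  have \<phi>_X: "\<phi> w \<in> space X" if "w \<in> C" for w using measurable_space[OF \<phi>] that space_C by auto
  have red_iff: "(x, y) \<in> E \<and> r = s \<longleftrightarrow> (\<phi> (x, r), \<phi> (y, s)) \<in> F" if "(x, r) \<in> C" "(y, s) \<in> C" for x y r s
    using bspec[OF bspec[OF \<phi>_red], of "(x, r)" "(y, s)"] that by (auto simp: space_C product_rel_def)
  have F_refl: "(x, x) \<in> F" if "x \<in> space X" for x using F(1) that by (auto simp: equiv_def refl_on_def)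

  \<comment> \<open>The parameter r is arbitrary but fixed, while \<open>R\<close> does not depend
    on it.\<close>
  have section_null: "{x. (x, r) \<in> C \<and> (x, \<phi> (x, r)) \<notin> R} \<in> null_sets m" for r
  proof -
    define B where "B = {x. (x, r) \<in> C}"
    have B: "B \<in> sets X" using sets_Pair2[OF C, of r] by (simp add: B_def vimage_def)
    have space_B: "space (restrict_space X B) = B" using C_X by (auto simp: B_def space_restrict_space)
    have "countable_to_one_hom (restrict_space X B) (Restr E B) X E (\<lambda>x. \<phi> (x, r))"
      unfolding countable_to_one_hom_def space_B
    proof (intro conjI ballI impI)
      have "(\<lambda>x. (x, r)) \<in> restrict_space X B \<rightarrow>\<^sub>M restrict_space (X \<Otimes>\<^sub>M borel) C"
        by (rule measurable_restrict_space3) (auto simp: B_def)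
      then show "(\<lambda>x. \<phi> (x, r)) \<in> restrict_space X B \<rightarrow>\<^sub>M X" by (rule measurable_compose[OF _ \<phi>])
      fix x y assume "x \<in> B" "y \<in> B" "(x, y) \<in> Restr E B"
      then show "(\<phi> (x, r), \<phi> (y, r)) \<in> E" using red_iff[of x r y r] F(2) by (auto simp: B_def)
    next
      fix y
      show "countable {x\<in>B. \<phi> (x, r) = y}"
      proof (cases "{x\<in>B. \<phi> (x, r) = y} = {}")
        case False
        then obtain x where x: "x \<in> B" "\<phi> (x, r) = y" by auto
        have "{x\<in>B. \<phi> (x, r) = y} \<subseteq> E `` {x}"
        proof
          fix x' assume x': "x' \<in> {x\<in>B. \<phi> (x, r) = y}"
          then have "(\<phi> (x, r), \<phi> (x', r)) \<in> F" using x F_refl \<phi>_X by (auto simp: B_def)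
          then show "x' \<in> E `` {x}" using red_iff[of x r x' r] x x' by (auto simp: B_def)
        qed
        moreover have "countable (E `` {x})" using x C_X by (intro E_cnt) (auto simp: B_def)
        ultimately show ?thesis by (rule countable_subset)
      qed (simp only: countable_empty)
    qed
    from R_null[OF B this] show ?thesis by (simp add: B_def)
  qed
  \<comment> \<open>Measurability of this set in the product licenses the exchange of quantifiers:
    from null sections at every r to a statement about almost every r for almost every x.\<close>
  define N where "N = {w \<in> space (restrict_space (X \<Otimes>\<^sub>M borel) C). (fst w, \<phi> w) \<notin> R}"
  have "fst \<in> restrict_space (X \<Otimes>\<^sub>M borel) C \<rightarrow>\<^sub>M X" by (rule measurable_restrict_space1) simp
  then have "N \<in> sets (restrict_space (X \<Otimes>\<^sub>M borel) C)" unfolding N_def by measurable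
  then have N [measurable]: "N \<in> sets (X \<Otimes>\<^sub>M borel)" using C by (simp add: sets_restrict_space_iff)
  have "emeasure (m \<Otimes>\<^sub>M \<Lambda>) N = (\<integral>\<^sup>+r. emeasure m ((\<lambda>x. (x, r)) -` N) \<partial>\<Lambda>)"
    by (rule P.emeasure_pair_measure_alt2) (simp add: sets_P N)
  also have "\<dots> = (\<integral>\<^sup>+r. 0 \<partial>\<Lambda>)"
  proof (rule nn_integral_cong)
    fix r
    have "(\<lambda>x. (x, r)) -` N = {x. (x, r) \<in> C \<and> (x, \<phi> (x, r)) \<notin> R}" by (auto simp: N_def space_C)
    then show "emeasure m ((\<lambda>x. (x, r)) -` N) = 0" using section_null[of r] by auto
  qed
  finally have "N \<in> null_sets (m \<Otimes>\<^sub>M \<Lambda>)" by (simp add: null_sets_def sets_P N)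
  then have "AE w in m \<Otimes>\<^sub>M \<Lambda>. w \<notin> N" by (rule AE_not_in)
  moreover have "AE w in m \<Otimes>\<^sub>M \<Lambda>. w \<notin> space (m \<Otimes>\<^sub>M \<Lambda>) - C"
    using C_conull by (intro AE_not_in) (simp add: conull_def)
  ultimately have "AE w in m \<Otimes>\<^sub>M \<Lambda>. w \<in> C \<and> (fst w, \<phi> w) \<in> R"
    using AE_space by eventually_elim (auto simp: N_def space_C)
  then have "AE x in m. AE r in \<Lambda>. (x, r) \<in> C \<and> (fst (x, r), \<phi> (x, r)) \<in> R"
    by (rule P.AE_pair)
  then have "AE x in m. x \<in> space X \<and> (AE r in \<Lambda>. (x, r) \<in> C \<and> (x, \<phi> (x, r)) \<in> R)"
    using AE_space by eventually_elim (auto simp: space_m)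
  then have "\<exists>x. x \<in> space X \<and> (AE r in \<Lambda>. (x, r) \<in> C \<and> (x, \<phi> (x, r)) \<in> R)"
    by (rule eventually_happens'[rotated]) (simp add: m.ae_filter_bot)
  then obtain x where x: "x \<in> space X" and AE_r: "AE r in \<Lambda>. (x, r) \<in> C \<and> (x, \<phi> (x, r)) \<in> R" by blast
  define A where "A = {r. (x, r) \<in> C \<and> (x, \<phi> (x, r)) \<in> R}"
  have "inj_on (\<lambda>r. \<phi> (x, r)) A"
  proof (rule inj_onI)
    fix r s assume rs: "r \<in> A" "s \<in> A" "\<phi> (x, r) = \<phi> (x, s)"
    then have "(\<phi> (x, r), \<phi> (x, s)) \<in> F" using F_refl \<phi>_X by (auto simp: A_def)
    then show "r = s" using red_iff[of x r x s] rs by (auto simp: A_def)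
  qed
  moreover have "countable ((\<lambda>r. \<phi> (x, r)) ` A)"
    by (rule countable_subset[OF _ R_cnt[OF x]]) (auto simp: A_def)
  ultimately have "countable A" by (rule countable_image_inj_on[rotated])
  from AE_r \<Lambda>_countable[OF this] have "AE r in \<Lambda>. False"
    by eventually_elim (auto simp: A_def)
  then show False by simp
qed

end
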